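(* Let $M\ge1$, $R_1,\dots,R_M\in\mathbb{R}^3$ and $d>0$ be fixed. Consider a sequence of data $(N,\underline{Z})$, $N\in\mathbb{N}$, $\underline{Z}=(Z_1,\dots,Z_M)$ with all $Z_\alpha>0$, such that $$N\to\infty,\quad Z=\sum_{\alpha=1}^M Z_\alpha\to\infty,\quad \frac{N}{Z}\to\lambda\in(0,\infty),\quad \frac{Z_\alpha}{Z}\to z_\alpha\ (\alpha=1,\dots,M),$$ and let $\underline{z}=(z_1,\dots,z_M)$. Then the sequence of functionals $\tilde V_{(N,\underline{Z})}:\mathcal{M}_+(\mathbb{R}^3\setminus\Omega)\to\mathbb{R}\cup\{+\infty\}$ Gamma-converges, with respect to weak* convergence of Radon measures, to the functional $I_{\lambda,\underline{z}}:\mathcal{M}_+(\mathbb{R}^3\setminus\Omega)\to\mathbb{R}\cup\{+\infty\}$, where $\tilde V_{(N,\underline{Z})}$, $I_{\lambda,\underline{z}}$ and Gamma-convergence are defined in the context.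
   Context: $\Omega=\bigcup_{\alpha=1}^M B_d(R_\alpha)$ with $B_d(R_\alpha)=\{x\in\mathbb{R}^3:|x-R_\alpha|<d\}$. $\mathcal{M}(\mathbb{R}^3\setminus\Omega)$ is the space of (finite, signed) Radon measures on the closed set $\mathbb{R}^3\setminus\Omega$, i.e. the dual of $C_0(\mathbb{R}^3\setminus\Omega)=\{f\text{ continuous},\ f(x)\to0\text{ as }|x|\to\infty\}$; $\mathcal{M}_+(\mathbb{R}^3\setminus\Omega)$ is its subset of nonnegative measures; $\mu_j\rightharpoonup^*\mu$ means $\int f\,d\mu_j\to\int f\,d\mu$ for all $f\in C_0(\mathbb{R}^3\setminus\Omega)$. With $\mathrm{diag}=\{(x,x):x\in\mathbb{R}^3\setminus\Omega\}$, define $$\tilde V_{(N,\underline{Z})}(\mu):=-\int_{\mathbb{R}^3\setminus\Omega}\sum_{\alpha=1}^M\frac{Z_\alpha}{Z}\frac{1}{|x-R_\alpha|}\,d\mu(x)+\frac12\iint_{(\mathbb{R}^3\setminus\Omega)^2\setminus\mathrm{diag}}\frac{1}{|x-y|}\,d\mu(x)\,d\mu(y)$$ if $\mu=\frac1Z\sum_{i=1}^N\delta_{x_i}$ for some distinct $x_1,\dots,x_N\in\mathbb{R}^3\setminus\Omega$, and $\tilde V_{(N,\underline{Z})}(\mu):=+\infty$ otherwise. Define $$I_{\lambda,\underline{z}}(\mu):=-\int_{\mathbb{R}^3\setminus\Omega}\sum_{\alpha=1}^M\frac{z_\alpha}{|x-R_\alpha|}\,d\mu(x)+\frac12\iint_{(\mathbb{R}^3\setminus\Omega)^2}\frac{1}{|x-y|}\,d\mu(x)\,d\mu(y)$$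 if $\int d\mu\le\lambda$ (with $1/|x-y|=+\infty$ for $x=y$), and $I_{\lambda,\underline{z}}(\mu):=+\infty$ otherwise. A sequence $I^{(j)}:X\to\mathbb{R}\cup\{\infty\}$ of functionals on a topological space $X$ is said to Gamma-converge to $I:X\to\mathbb{R}\cup\{\infty\}$ if for all $\mu\in X$: (i) for every sequence $\mu_j\in X$ converging to $\mu$, $I(\mu)\le\liminf_{j\to\infty}I^{(j)}(\mu_j)$; (ii) there exists a sequence $\mu_j\in X$ converging to $\mu$ such that $I(\mu)=\lim_{j\to\infty}I^{(j)}(\mu_j)$. *)

theory Defs
  imports "HOL-Probability.Probability"
begin

definition exterior :: "nat \<Rightarrow> (nat \<Rightarrow> real^3) \<Rightarrow> real \<Rightarrow> (real^3) set" where
  "exterior M R d = UNIV - (\<Union>\<alpha>\<in>{1..M}. ball (R \<alpha>) d)"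

definition C0 :: "('a::real_normed_vector) set \<Rightarrow> ('a \<Rightarrow> real) set" where
  "C0 F = {f. continuous_on F f \<and> (f \<longlongrightarrow> 0) (inf at_infinity (principal F))}"

definition radon_measures_pos :: "('a::real_normed_vector) set \<Rightarrow> 'a measure set" where
  "radon_measures_pos F = {\<mu>. sets \<mu> = sets (restrict_space borel F) \<and> finite_measure \<mu> \<and>
     (\<forall>A\<in>sets \<mu>. emeasure \<mu> A = (SUP K\<in>{K. compact K \<and> K \<subseteq> A}. emeasure \<mu> K))}"

text \<open>The weak* topology on the nonnegative measures: the coarsest topology making all the maps
  \<open>\<mu> \<mapsto> \<integral>f d\<mu>\<close> with \<open>f \<in> C\<^sub>0\<close> continuous.  Its convergent sequences are described in
  \<open>limitin_weak_star\<close> below.\<close>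

definition weak_star_topology :: "('a::real_normed_vector) set \<Rightarrow> 'a measure topology" where
  "weak_star_topology F =
     pullback_topology (radon_measures_pos F) (\<lambda>\<mu>. \<lambda>f\<in>C0 F. \<integral>x. f x \<partial>\<mu>)
       (product_topology (\<lambda>_. euclidean) (C0 F))"

definition dirac_sum :: "('a::topological_space) set \<Rightarrow> real \<Rightarrow> nat \<Rightarrow> (nat \<Rightarrow> 'a) \<Rightarrow> 'a measure" where
  "dirac_sum F c N x = measure_of F (sets (restrict_space borel F))
     (\<lambda>A. ennreal c * (\<Sum>i=1..N. emeasure (return (restrict_space borel F) (x i)) A))"

text \<open>In \<open>ennreal\<close> one has \<open>1 / 0 = \<infinity>\<close>, so this kernel is \<open>+\<infinity>\<close> on the diagonal.\<close>

definition coulomb :: "'a::real_normed_vector \<Rightarrow> 'a \<Rightarrow> ennreal" where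
  "coulomb x y = 1 / ennreal (norm (x - y))"

text \<open>The two integrals below have integrators living on \<open>exterior M R d\<close>.  For \<open>d > 0\<close> the first
  one is the integral of a bounded function against a finite measure, hence a real number; the
  second one is the integral of a nonnegative function and takes values in \<open>[0,\<infinity>]\<close>.\<close>

definition attraction :: "nat \<Rightarrow> (nat \<Rightarrow> real^3) \<Rightarrow> (nat \<Rightarrow> real) \<Rightarrow> (real^3) measure \<Rightarrow> real" where
  "attraction M R w \<mu> = (\<integral>x. (\<Sum>\<alpha>=1..M. w \<alpha> * (1 / norm (x - R \<alpha>))) \<partial>\<mu>)"

definition repulsion :: "('a::real_normed_vector \<times> 'a) set \<Rightarrow> 'a measure \<Rightarrow> ereal" where
  "repulsion S \<mu> = enn2ereal (\<integral>\<^sup>+p\<in>S. coulomb (fst p) (snd p) \<partial>(\<mu> \<Otimes>\<^sub>M \<mu>))"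

definition V_tilde ::
  "nat \<Rightarrow> (nat \<Rightarrow> real^3) \<Rightarrow> real \<Rightarrow> nat \<Rightarrow> (nat \<Rightarrow> real) \<Rightarrow> (real^3) measure \<Rightarrow> ereal" where
  "V_tilde M R d N Z \<mu> =
     (let F = exterior M R d; Ztot = (\<Sum>\<alpha>=1..M. Z \<alpha>) in
      if \<exists>x. inj_on x {1..N} \<and> x ` {1..N} \<subseteq> F \<and> \<mu> = dirac_sum F (1 / Ztot) N x
      then - ereal (attraction M R (\<lambda>\<alpha>. Z \<alpha> / Ztot) \<mu>)
           + ereal (1/2) * repulsion (F \<times> F - {(x, x) |x. x \<in> F}) \<mu>
      else \<infinity>)"

definition I_limit ::
  "nat \<Rightarrow> (nat \<Rightarrow> real^3) \<Rightarrow> real \<Rightarrow> real \<Rightarrow> (nat \<Rightarrow> real) \<Rightarrow> (real^3) measure \<Rightarrow> ereal" where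
  "I_limit M R d \<Lambda> z \<mu> =
     (let F = exterior M R d in
      if measure \<mu> F \<le> \<Lambda>
      then - ereal (attraction M R z \<mu>) + ereal (1/2) * repulsion (F \<times> F) \<mu>
      else \<infinity>)"

definition gamma_converges ::
  "'a topology \<Rightarrow> (nat \<Rightarrow> 'a \<Rightarrow> ereal) \<Rightarrow> ('a \<Rightarrow> ereal) \<Rightarrow> bool" where
  "gamma_converges X J I \<longleftrightarrow>
     (\<forall>\<mu>\<in>topspace X.
        (\<forall>\<mu>s. (\<forall>j. \<mu>s j \<in> topspace X) \<and> limitin X \<mu>s \<mu> sequentially \<longrightarrow>
           I \<mu> \<le> liminf (\<lambda>j. J j (\<mu>s j))) \<and>
        (\<exists>\<mu>s. (\<forall>j. \<mu>s j \<in> topspace X) \<and> limitin X \<mu>s \<mu> sequentially \<and>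
           (\<lambda>j. J j (\<mu>s j)) \<longlonglongrightarrow> I \<mu>))"

lemma topspace_weak_star [simp]: "topspace (weak_star_topology F) = radon_measures_pos F"
  by (auto simp: weak_star_topology_def topspace_pullback_topology)

lemma limitin_pullback_topology:
  "limitin (pullback_topology A f T) s l G \<longleftrightarrow>
     l \<in> A \<and> (\<forall>\<^sub>F j in G. s j \<in> A) \<and> limitin T (\<lambda>j. f (s j)) (f l) G"
    (is "?L \<longleftrightarrow> ?R")
proof
  assume L: ?L
  have l: "l \<in> A" "f l \<in> topspace T"
    using L by (auto simp: limitin_def topspace_pullback_topology)
  have ev: "\<forall>\<^sub>F j in G. s j \<in> f -` U \<inter> A" if "openin T U" "f l \<in> U" for U
    using L that l unfolding limitin_def openin_pullback_topology by blast
  have "\<forall>\<^sub>F j in G. s j \<in> A"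
    using ev[of "topspace T"] l by (auto elim: eventually_mono)
  moreover have "limitin T (\<lambda>j. f (s j)) (f l) G"
    unfolding limitin_def
  proof (intro conjI allI impI)
    fix U assume "openin T U \<and> f l \<in> U"
    then have "\<forall>\<^sub>F j in G. s j \<in> f -` U \<inter> A" using ev by blast
    then show "\<forall>\<^sub>F j in G. f (s j) \<in> U" by eventually_elim auto
  qed (use l in auto)
  ultimately show ?R using l by blast
next
  assume R: ?R
  show ?L
    unfolding limitin_def openin_pullback_topology topspace_pullback_topology
  proof (intro conjI allI impI)
    show "l \<in> f -` topspace T \<inter> A"
      using R by (auto simp: limitin_def)
  next
    fix S assume "(\<exists>U. openin T U \<and> S = f -` U \<inter> A) \<and> l \<in> S"
    then obtain U where U: "openin T U" "S = f -` U \<inter> A" "f l \<in> U" by auto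
    then have "\<forall>\<^sub>F j in G. f (s j) \<in> U" using R by (auto simp: limitin_def)
    moreover have "\<forall>\<^sub>F j in G. s j \<in> A" using R by blast
    ultimately show "\<forall>\<^sub>F j in G. s j \<in> S"
      by eventually_elim (auto simp: U)
  qed
qed

lemma limitin_weak_star:
  assumes "\<And>j. \<mu>s j \<in> radon_measures_pos F" "\<mu> \<in> radon_measures_pos F"
  shows "limitin (weak_star_topology F) \<mu>s \<mu> sequentially \<longleftrightarrow>
    (\<forall>f\<in>C0 F. (\<lambda>j. \<integral>x. f x \<partial>(\<mu>s j)) \<longlonglongrightarrow> (\<integral>x. f x \<partial>\<mu>))"
  using assms
  by (simp add: weak_star_topology_def limitin_pullback_topology limitin_componentwise)

lemma sets_dirac_sum [simp]: "sets (dirac_sum F c N x) = sets (restrict_space borel F)"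
  unfolding dirac_sum_def
  by (metis sets.sets_measure_of_eq space_restrict_space2 space_borel space_restrict_space
      Int_UNIV_right)

lemma emeasure_dirac_sum:
  assumes "A \<in> sets (restrict_space borel F)"
  shows "emeasure (dirac_sum F c N x) A =
    ennreal c * (\<Sum>i=1..N. emeasure (return (restrict_space borel F) (x i)) A)"
proof (rule emeasure_measure_of[OF dirac_sum_def])
  let ?B = "restrict_space borel F"
  let ?m = "\<lambda>A. ennreal c * (\<Sum>i=1..N. emeasure (return ?B (x i)) A)"
  show "sets ?B \<subseteq> Pow F"
    using sets.space_closed[of ?B] by (simp add: space_restrict_space)
  show "A \<in> sets (dirac_sum F c N x)" using assms by simp
  show "positive (sets (dirac_sum F c N x)) ?m"
    by (simp add: positive_def)
  show "countably_additive (sets (dirac_sum F c N x)) ?m"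
  proof (rule countably_additiveI)
    fix A :: "nat \<Rightarrow> 'a set"
    assume A: "range A \<subseteq> sets (dirac_sum F c N x)" "disjoint_family A"
    have "(\<Sum>k. ?m (A k)) = ennreal c * (\<Sum>i=1..N. \<Sum>k. emeasure (return ?B (x i)) (A k))"
      by (simp add: ennreal_suminf_cmult suminf_sum)
    also have "(\<lambda>i. \<Sum>k. emeasure (return ?B (x i)) (A k)) =
        (\<lambda>i. emeasure (return ?B (x i)) (\<Union>k. A k))"
    proof
      fix i
      show "(\<Sum>k. emeasure (return ?B (x i)) (A k)) = emeasure (return ?B (x i)) (\<Union>k. A k)"
        by (rule suminf_emeasure) (use A in simp_all)
    qed
    finally show "(\<Sum>k. ?m (A k)) = ?m (\<Union>k. A k)" .
  qed
qed

lemma V_tilde_not_MInf: "V_tilde M R d N Z \<mu> \<noteq> -\<infinity>"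
  and I_limit_not_MInf: "I_limit M R d \<Lambda> z \<mu> \<noteq> -\<infinity>"
proof -
  have "ereal (1/2) * repulsion S \<mu> \<ge> 0" for S and \<mu> :: "(real^3) measure"
    by (simp add: repulsion_def)
  then have *: "- ereal a + ereal (1/2) * repulsion S \<mu> \<noteq> -\<infinity>"
    for a S and \<mu> :: "(real^3) measure"
    by (metis MInfty_neq_ereal(1) ereal_infty_less_eq(2) ereal_plus_eq_MInfty uminus_ereal.simps(1)
        zero_ereal_def)
  show "V_tilde M R d N Z \<mu> \<noteq> -\<infinity>" "I_limit M R d \<Lambda> z \<mu> \<noteq> -\<infinity>"
    using * by (auto simp: V_tilde_def I_limit_def Let_def)
qed

lemma coulomb_diag: "coulomb x x = \<infinity>"
  by (simp add: coulomb_def divide_ennreal_def)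

lemma attraction_integrable:
  assumes "\<mu> \<in> radon_measures_pos (exterior M R d)" "d > 0"
  shows "integrable \<mu> (\<lambda>x. \<Sum>\<alpha>=1..M. w \<alpha> * (1 / norm (x - R \<alpha>)))"
proof -
  interpret finite_measure \<mu> using assms by (simp add: radon_measures_pos_def)
  have s [measurable_cong]: "sets \<mu> = sets (restrict_space borel (exterior M R d))"
    using assms by (simp add: radon_measures_pos_def)
  have sp: "space \<mu> = exterior M R d"
    using sets_eq_imp_space_eq[OF s] by (simp add: space_restrict_space)
  have "integrable \<mu> (\<lambda>x. 1 / norm (x - R \<alpha>))" if "\<alpha> \<in> {1..M}" for \<alpha>
  proof (rule integrable_const_bound[where B = "1 / d"])
    have "norm (1 / norm (x - R \<alpha>)) \<le> 1 / d" if "x \<in> space \<mu>" for x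
    proof -
      have "norm (x - R \<alpha>) \<ge> d"
        using that \<open>\<alpha> \<in> {1..M}\<close> by (force simp: sp exterior_def dist_norm norm_minus_commute)
      then show ?thesis using \<open>d > 0\<close> by (simp add: frac_le)
    qed
    then show "AE x in \<mu>. norm (1 / norm (x - R \<alpha>)) \<le> 1 / d" by simp
    have "(\<lambda>x. 1 / norm (x - R \<alpha>)) \<in> borel_measurable borel" by measurable
    then show "(\<lambda>x. 1 / norm (x - R \<alpha>)) \<in> borel_measurable \<mu>"
      using measurable_restrict_space1 measurable_cong_sets[OF s refl] by blast
  qed
  then show ?thesis by (intro Bochner_Integration.integrable_sum integrable_mult_right) auto
qed

end

theory Submission
  imports Defs
begin

text \<open>
  Lower bound: replacing \<open>1 / |x - y|\<close> by \<open>1 / max \<delta> |x - y|\<close> (and cutting off one variable) makes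
  the double integral continuous along weak* convergent sequences of bounded mass, by
  equicontinuity of the potentials. For \<open>N\<close> point masses of weight \<open>1 / Z\<close> the diagonal
  contributes at most \<open>N / (Z\<^sup>2 \<delta>)\<close>, which vanishes in the limit; then \<open>\<delta> \<rightarrow> 0\<close> by Fatou.

  Upper bound: a measure of finite energy and mass \<open>m \<le> \<Lambda>\<close> is approximated by random sampling.
  For \<open>n\<close> independent points drawn from \<open>\<mu> / m\<close> the expected off-diagonal energy is at most that
  of \<open>\<mu> / m\<close>, and the empirical frequencies of countably many test sets concentrate, so some
  sample has nearly optimal energy and nearly correct frequencies. This needs no regularity of
  the exterior domain, which may have isolated points. About \<open>m Z\<close> particles are sampled; the
  others are sent to infinity, far apart from each other. If the limit energy is infinite, the
  constant sequence is a recovery sequence by the lower bound.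
\<close>

text \<open>Weak* convergence does not see mass that escapes to infinity, because the test functions
  vanish there. This is why the limit functional carries the mass constraint as an inequality, and
  why surplus particles may be sent away. The kernel fails as a test function for two reasons: it is
  singular on the diagonal, and along the diagonal it does not decay. Capping it at 1/\<delta> cures
  the first defect. Cutting off one variable cures the second, since for x in a bounded set the
  capped kernel decays in y. The cap also gives the point masses a finite self-interaction, which
  can then be estimated. In the upper bound the sampled points must lie in the exterior domain and
  be distinct. The first holds because they are drawn from the measure itself, the second because
  the kernel is infinite on the diagonal, so that a sample of finite energy has no coincidences.
  Finite unions of basis sets serve as test sets because they form one countable family that does
  not depend on the test function.\<close>

section \<open>Radon measures and test functions\<close>

lemma radon_measures_posD:
  assumes "\<mu> \<in> radon_measures_pos F"
  shows sets_radon: "sets \<mu> = sets (restrict_space borel F)"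
    and space_radon: "space \<mu> = F"
    and finite_measure_radon: "finite_measure \<mu>"
proof -
  show s: "sets \<mu> = sets (restrict_space borel F)" and "finite_measure \<mu>"
    using assms by (auto simp: radon_measures_pos_def)
  show "space \<mu> = F"
    using sets_eq_imp_space_eq[OF s] by (simp add: space_restrict_space)
qed

lemma measurable_radon:
  assumes "\<mu> \<in> radon_measures_pos F" "f \<in> borel \<rightarrow>\<^sub>M N"
  shows "f \<in> \<mu> \<rightarrow>\<^sub>M N"
  using measurable_restrict_space1[OF assms(2), of F]
    measurable_cong_sets[OF sets_radon[OF assms(1)] refl] by blast

lemma C0_iff:
  "f \<in> C0 F \<longleftrightarrow> continuous_on F f \<and> (\<forall>e>0. \<exists>b. \<forall>x\<in>F. b \<le> norm x \<longrightarrow> \<bar>f x\<bar> < e)"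
proof -
  have "(\<forall>x\<in>F. b \<le> norm x \<longrightarrow> \<bar>f x\<bar> < e) \<longleftrightarrow> (\<forall>x. b \<le> norm x \<longrightarrow> x \<in> F \<longrightarrow> \<bar>f x - 0\<bar> < e)" for b e
    by auto
  then show ?thesis
    unfolding C0_def tendsto_iff eventually_inf_principal eventually_at_infinity dist_real_def
    by simp
qed

lemma C0I_tendsto:
  assumes "continuous_on F f" "(f \<longlongrightarrow> 0) at_infinity"
  shows "f \<in> C0 F"
  using assms tendsto_mono[OF inf_le1] by (auto simp: C0_def)

lemma C0_bounded:
  fixes F :: "'a::euclidean_space set"
  assumes "closed F" "f \<in> C0 F"
  obtains B where "B > 0" "\<And>x. x \<in> F \<Longrightarrow> \<bar>f x\<bar> \<le> B"
proof -
  obtain b where b: "\<And>x. x \<in> F \<Longrightarrow> b \<le> norm x \<Longrightarrow> \<bar>f x\<bar> < 1"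
    using assms(2) unfolding C0_iff by (metis zero_less_one)
  have "compact (F \<inter> cball 0 b)" using assms(1) by (simp add: closed_Int_compact)
  then have "compact (f ` (F \<inter> cball 0 b))"
    using assms(2) by (intro compact_continuous_image) (auto simp: C0_iff intro: continuous_on_subset)
  then obtain B where B: "\<And>y. y \<in> f ` (F \<inter> cball 0 b) \<Longrightarrow> norm y \<le> B"
    using compact_imp_bounded bounded_iff by metis
  show thesis
  proof (rule that[of "max B 1"])
    show "\<bar>f x\<bar> \<le> max B 1" if "x \<in> F" for x
      using b[OF that] B[of "f x"] that by (cases "b \<le> norm x") (force simp: mem_cball)+
  qed simp
qed

lemma integrable_C0:
  fixes F :: "'a::euclidean_space set"
  assumes "closed F" "f \<in> C0 F" "\<mu> \<in> radon_measures_pos F"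
  shows "integrable \<mu> f"
proof -
  interpret finite_measure \<mu> using finite_measure_radon[OF assms(3)] .
  obtain B where B: "\<And>x. x \<in> F \<Longrightarrow> \<bar>f x\<bar> \<le> B" using C0_bounded[OF assms(1,2)] by blast
  have "f \<in> borel_measurable (restrict_space borel F)"
    using assms(2) by (intro borel_measurable_continuous_on_restrict) (simp add: C0_iff)
  then have "f \<in> borel_measurable \<mu>"
    using measurable_cong_sets[OF sets_radon[OF assms(3)] refl] by blast
  then show ?thesis
    using B by (intro integrable_const_bound[of _ B]) (auto simp: space_radon[OF assms(3)])
qed

lemma filterlim_norm_diff: "filterlim (\<lambda>x::'a::real_normed_vector. norm (x - a)) at_top at_infinity"
  by (intro filterlim_at_infinity_imp_norm_at_top)
     (use tendsto_add_filterlim_at_infinity[of "\<lambda>_. - a" "-a" at_infinity "\<lambda>x. x"] in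
       \<open>simp add: filterlim_ident\<close>)

lemma C0_inverse_dist:
  assumes "d > 0" "\<And>x. x \<in> F \<Longrightarrow> norm (x - a) \<ge> d"
  shows "(\<lambda>x. 1 / norm (x - a)) \<in> C0 F"
proof (rule C0I_tendsto)
  show "continuous_on F (\<lambda>x. 1 / norm (x - a))"
    using assms by (intro continuous_intros) fastforce
  show "((\<lambda>x. 1 / norm (x - a)) \<longlongrightarrow> 0) at_infinity"
    by (rule real_tendsto_divide_at_top[OF tendsto_const filterlim_norm_diff])
qed

section \<open>The capped kernel and the cutoff\<close>

text \<open>The Coulomb kernel capped at height 1/\<delta>. With the maximum in the denominator its
  diagonal value is 1/\<delta>; the form \<open>min (1 / \<delta>) (1 / norm (x - y))\<close> would
  give 0 there, because 1 / 0 = 0 in the reals.\<close>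

definition soft_coulomb :: "real \<Rightarrow> 'a::real_normed_vector \<Rightarrow> 'a \<Rightarrow> real" where
  "soft_coulomb \<delta> x y = 1 / max \<delta> (norm (x - y))"

text \<open>A compactly supported stand-in for the constant 1, which does not vanish at
  infinity.\<close>

definition cutoff :: "real \<Rightarrow> 'a::real_normed_vector \<Rightarrow> real" where
  "cutoff r x = max 0 (min 1 (r + 1 - norm x))"

lemma cutoff_bounds: "0 \<le> cutoff r x" "cutoff r x \<le> 1"
  and cutoff_zero: "norm x \<ge> r + 1 \<Longrightarrow> cutoff r x = 0"
  and cutoff_one: "norm x \<le> r \<Longrightarrow> cutoff r x = 1"
  by (auto simp: cutoff_def)

lemma continuous_on_cutoff: "continuous_on S (cutoff r)"
  unfolding cutoff_def by (intro continuous_intros)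

lemma soft_coulomb_bounds:
  assumes "\<delta> > 0"
  shows "0 \<le> soft_coulomb \<delta> x y" "soft_coulomb \<delta> x y \<le> 1 / \<delta>"
    "x \<noteq> y \<Longrightarrow> soft_coulomb \<delta> x y \<le> 1 / norm (x - y)"
  using assms by (auto simp: soft_coulomb_def frac_le)

text \<open>On t \<ge> \<delta> the function 1/t has Lipschitz constant 1/\<delta>^2, and the
  distance to y is 1-Lipschitz. The constant is the same for all y, so it survives integration in y
  and makes potentials of bounded mass equicontinuous.\<close>

lemma soft_coulomb_Lipschitz:
  assumes "\<delta> > 0"
  shows "\<bar>soft_coulomb \<delta> x y - soft_coulomb \<delta> x' y\<bar> \<le> norm (x - x') / \<delta>\<^sup>2"
proof -
  let ?a = "max \<delta> (norm (x - y))" and ?b = "max \<delta> (norm (x' - y))"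
  have ab: "?a \<ge> \<delta>" "?b \<ge> \<delta>" "?a > 0" "?b > 0" using assms by auto
  have "\<bar>?b - ?a\<bar> \<le> \<bar>norm (x' - y) - norm (x - y)\<bar>" by auto
  also have "\<dots> \<le> norm (x - x')"
    using norm_triangle_ineq3[of "x' - y" "x - y"] by (simp add: norm_minus_commute)
  finally have n: "\<bar>?b - ?a\<bar> \<le> norm (x - x')" .
  have "\<bar>soft_coulomb \<delta> x y - soft_coulomb \<delta> x' y\<bar> = \<bar>?b - ?a\<bar> / (?a * ?b)"
    using ab by (simp add: soft_coulomb_def diff_frac_eq abs_mult)
  also have "\<dots> \<le> norm (x - x') / (\<delta> * \<delta>)"
    using ab assms n by (intro frac_le mult_mono) auto
  finally show ?thesis by (simp add: power2_eq_square)
qed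

lemma continuous_on_soft_coulomb:
  "\<delta> > 0 \<Longrightarrow> continuous_on S (soft_coulomb \<delta> x)"
  unfolding soft_coulomb_def by (intro continuous_intros) (use max.strict_coboundedI1 in force)

lemma C0_soft_coulomb:
  assumes "\<delta> > 0"
  shows "soft_coulomb \<delta> x \<in> C0 F"
proof (rule C0I_tendsto[OF continuous_on_soft_coulomb[OF assms]])
  have "filterlim (\<lambda>y. norm (x - y)) at_top at_infinity"
    using filterlim_norm_diff[of x] by (simp add: norm_minus_commute)
  then have "filterlim (\<lambda>y. max \<delta> (norm (x - y))) at_top at_infinity"
    by (rule filterlim_at_top_mono) auto
  then show "(soft_coulomb \<delta> x \<longlongrightarrow> 0) at_infinity"
    unfolding soft_coulomb_def by (rule real_tendsto_divide_at_top[OF tendsto_const])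
qed

lemma borel_measurable_soft_coulomb [measurable]:
  "(\<lambda>p::'a::euclidean_space \<times> 'a. soft_coulomb \<delta> (fst p) (snd p)) \<in> borel_measurable (borel \<Otimes>\<^sub>M borel)"
  unfolding soft_coulomb_def by measurable

lemma borel_measurable_cutoff [measurable]:
  "(cutoff r :: 'a::euclidean_space \<Rightarrow> real) \<in> borel_measurable borel"
  unfolding cutoff_def by measurable

lemma borel_measurable_coulomb [measurable]:
  "(\<lambda>p::'a::euclidean_space \<times> 'a. coulomb (fst p) (snd p)) \<in> borel_measurable (borel \<Otimes>\<^sub>M borel)"
  unfolding coulomb_def by measurable

lemma measurable_pair_radon:
  fixes F :: "'a::euclidean_space set"
  assumes "\<mu> \<in> radon_measures_pos F" "f \<in> borel_measurable (borel \<Otimes>\<^sub>M borel)"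
  shows "f \<in> borel_measurable (\<mu> \<Otimes>\<^sub>M \<mu>)"
proof -
  have "(\<lambda>x. x) \<in> \<mu> \<rightarrow>\<^sub>M borel"
    by (rule measurable_radon[OF assms(1)]) simp
  then have "(\<lambda>p. (fst p, snd p)) \<in> \<mu> \<Otimes>\<^sub>M \<mu> \<rightarrow>\<^sub>M borel \<Otimes>\<^sub>M borel"
    by (intro measurable_Pair) (auto intro: measurable_compose[OF measurable_fst] measurable_compose[OF measurable_snd])
  from measurable_compose[OF this assms(2)] show ?thesis by simp
qed

lemma coulomb_eq: "x \<noteq> y \<Longrightarrow> coulomb x y = ennreal (1 / norm (x - y))"
  by (simp add: coulomb_def divide_ennreal flip: ennreal_1)

section \<open>Sums of point masses\<close>

text \<open>Gives access to the change-of-variables formulas for \<open>distr\<close>, which turn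
  integrals against \<open>dirac_sum\<close> into finite sums.\<close>

lemma dirac_sum_eq_distr:
  assumes "x ` {1..N} \<subseteq> F"
  shows "dirac_sum F c N x =
    distr (point_measure {1..N} (\<lambda>_. ennreal c)) (restrict_space borel F) x"
proof (rule measure_eqI)
  show "sets (dirac_sum F c N x) =
      sets (distr (point_measure {1..N} (\<lambda>_. ennreal c)) (restrict_space borel F) x)" by simp
next
  fix A assume "A \<in> sets (dirac_sum F c N x)"
  then have A: "A \<in> sets (restrict_space borel F)" by simp
  have x: "x \<in> point_measure {1..N} (\<lambda>_. ennreal c) \<rightarrow>\<^sub>M restrict_space borel F"
    using assms by (simp add: measurable_point_measure_eq1 space_restrict_space Pi_iff image_subset_iff)
  have "emeasure (distr (point_measure {1..N} (\<lambda>_. ennreal c)) (restrict_space borel F) x) A =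
      (\<integral>\<^sup>+y. indicator A y \<partial>distr (point_measure {1..N} (\<lambda>_. ennreal c)) (restrict_space borel F) x)"
    using A by simp
  also have "\<dots> = (\<integral>\<^sup>+i. indicator A (x i) \<partial>point_measure {1..N} (\<lambda>_. ennreal c))"
    using A by (intro nn_integral_distr[OF x]) simp
  also have "\<dots> = (\<Sum>i=1..N. ennreal c * indicator A (x i))"
    by (subst nn_integral_point_measure_finite) (auto simp: mult.commute)
  also have "\<dots> = emeasure (dirac_sum F c N x) A"
    using A by (simp add: emeasure_dirac_sum sum_distrib_left)
  finally show "emeasure (dirac_sum F c N x) A =
      emeasure (distr (point_measure {1..N} (\<lambda>_. ennreal c)) (restrict_space borel F) x) A" ..
qed

lemma nn_integral_dirac_sum:
  assumes "x ` {1..N} \<subseteq> F" "g \<in> borel_measurable (restrict_space borel F)"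
  shows "(\<integral>\<^sup>+y. g y \<partial>dirac_sum F c N x) = ennreal c * (\<Sum>i=1..N. g (x i))"
proof -
  have x: "x \<in> point_measure {1..N} (\<lambda>_. ennreal c) \<rightarrow>\<^sub>M restrict_space borel F"
    using assms by (simp add: measurable_point_measure_eq1 space_restrict_space Pi_iff image_subset_iff)
  show ?thesis
    unfolding dirac_sum_eq_distr[OF assms(1)]
    using assms(2) by (subst nn_integral_distr[OF x], simp, subst nn_integral_point_measure_finite) (auto simp: mult.commute sum_distrib_left)
qed

lemma integral_dirac_sum:
  fixes g :: "'a::topological_space \<Rightarrow> real"
  assumes "x ` {1..N} \<subseteq> F" "g \<in> borel_measurable (restrict_space borel F)" "c \<ge> 0"
  shows "(\<integral>y. g y \<partial>dirac_sum F c N x) = c * (\<Sum>i=1..N. g (x i))"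
proof -
  have x: "x \<in> point_measure {1..N} (\<lambda>_. ennreal c) \<rightarrow>\<^sub>M restrict_space borel F"
    using assms by (simp add: measurable_point_measure_eq1 space_restrict_space Pi_iff image_subset_iff)
  show ?thesis
    unfolding dirac_sum_eq_distr[OF assms(1)] integral_distr[OF x assms(2)]
    using assms(3) by (subst lebesgue_integral_point_measure_finite) (auto simp: sum_distrib_left)
qed

lemma emeasure_dirac_sum_space:
  assumes "x ` {1..N} \<subseteq> F"
  shows "emeasure (dirac_sum F c N x) F = ennreal c * of_nat N"
proof -
  have "F \<in> sets (restrict_space borel F)"
    using sets.top[of "restrict_space borel F"] by (simp add: space_restrict_space)
  then have "emeasure (dirac_sum F c N x) F = ennreal c * (\<Sum>i=1..N. indicator F (x i))"
    by (simp add: emeasure_dirac_sum)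
  also have "(\<Sum>i=1..N. indicator F (x i) :: ennreal) = (\<Sum>i=1..N. 1)"
    using assms by (intro sum.cong) (auto simp: image_subset_iff)
  finally show ?thesis by simp
qed

lemma measure_dirac_sum_space:
  assumes "x ` {1..N} \<subseteq> F" "c \<ge> 0"
  shows "measure (dirac_sum F c N x) F = c * real N"
  using assms emeasure_dirac_sum_space[OF assms(1), of c]
  by (simp add: measure_def enn2real_mult)

lemma dirac_sum_radon:
  fixes F :: "'a::{t2_space, real_normed_vector} set"
  assumes "x ` {1..N} \<subseteq> F"
  shows "dirac_sum F c N x \<in> radon_measures_pos F"
  unfolding radon_measures_pos_def
proof (intro CollectI conjI ballI)
  let ?\<mu> = "dirac_sum F c N x"
  show "sets ?\<mu> = sets (restrict_space borel F)" by simp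
  from sets_eq_imp_space_eq[OF this] have "space ?\<mu> = F" by (simp add: space_restrict_space)
  then show "finite_measure ?\<mu>"
    using emeasure_dirac_sum_space[OF assms, of c]
    by (intro finite_measureI) (simp add: ennreal_mult_eq_top_iff)
  fix A assume A: "A \<in> sets ?\<mu>"
  show "emeasure ?\<mu> A = (SUP K\<in>{K. compact K \<and> K \<subseteq> A}. emeasure ?\<mu> K)"
  proof (rule antisym)
    \<comment> \<open>The atoms lying in A form a finite, hence compact, set that carries all the
      mass of A, so the supremum is attained.\<close>
    let ?K = "A \<inter> x ` {1..N}"
    have "x ` {1..N} \<in> sets borel" by (simp add: borel_closed finite_imp_closed)
    then have "F \<inter> x ` {1..N} \<in> sets (restrict_space borel F)"
      by (auto simp: sets_restrict_space)
    moreover have "F \<inter> x ` {1..N} = x ` {1..N}" using assms by auto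
    ultimately have K: "?K \<in> sets (restrict_space borel F)"
      using A by auto
    have "emeasure ?\<mu> A = emeasure ?\<mu> ?K"
      using A K unfolding sets_dirac_sum
      by (simp only: emeasure_dirac_sum, intro arg_cong2[of _ _ _ _ "(*)"] sum.cong)
         (auto simp: indicator_def)
    also have "\<dots> \<le> (SUP K\<in>{K. compact K \<and> K \<subseteq> A}. emeasure ?\<mu> K)"
      by (intro SUP_upper) (auto intro: finite_imp_compact)
    finally show "emeasure ?\<mu> A \<le> (SUP K\<in>{K. compact K \<and> K \<subseteq> A}. emeasure ?\<mu> K)" .
    show "(SUP K\<in>{K. compact K \<and> K \<subseteq> A}. emeasure ?\<mu> K) \<le> emeasure ?\<mu> A"
      using A by (intro SUP_least emeasure_mono) auto
  qed
qed

text \<open>In the double sum below the terms with \<open>i = k\<close> vanish, because \<open>1 / 0 = 0\<close> in the reals.\<close>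

lemma repulsion_dirac_sum:
  fixes F :: "'a::euclidean_space set"
  assumes x: "x ` {1..N} \<subseteq> F" and inj: "inj_on x {1..N}" and c: "c \<ge> 0"
  shows "repulsion (F \<times> F - {(x, x) |x. x \<in> F}) (dirac_sum F c N x) =
    ereal (c\<^sup>2 * (\<Sum>i=1..N. \<Sum>k=1..N. 1 / norm (x i - x k)))"
proof -
  let ?\<mu> = "dirac_sum F c N x" and ?S = "F \<times> F - {(x, x) |x. x \<in> F}"
  have rad: "?\<mu> \<in> radon_measures_pos F" using dirac_sum_radon[OF x] .
  interpret finite_measure ?\<mu> using finite_measure_radon[OF rad] .
  \<comment> \<open>The removal of the diagonal is absorbed into the integrand, so that Tonelli
    applies on the full product.\<close>
  define g where "g p = (if fst p = snd p then 0 else coulomb (fst p) (snd p))" for p :: "'a \<times> 'a"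
  have g: "g \<in> borel_measurable (borel \<Otimes>\<^sub>M borel)" unfolding g_def by measurable
  have g2: "g \<in> borel_measurable (?\<mu> \<Otimes>\<^sub>M ?\<mu>)" by (rule measurable_pair_radon[OF rad g])
  have gx: "(\<lambda>b. g (a, b)) \<in> borel_measurable (restrict_space borel F)" for a
    using measurable_compose[OF measurable_Pair1' g, of a] by (intro measurable_restrict_space1) simp
  have "(\<integral>\<^sup>+p\<in>?S. coulomb (fst p) (snd p) \<partial>(?\<mu> \<Otimes>\<^sub>M ?\<mu>)) = (\<integral>\<^sup>+p. g p \<partial>(?\<mu> \<Otimes>\<^sub>M ?\<mu>))"
    by (intro nn_integral_cong) (auto simp: g_def space_pair_measure space_radon[OF rad] indicator_def)
  also have "\<dots> = (\<integral>\<^sup>+a. \<integral>\<^sup>+b. g (a, b) \<partial>?\<mu> \<partial>?\<mu>)"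
    by (rule nn_integral_fst[OF g2, symmetric])
  also have "\<dots> = (\<integral>\<^sup>+a. ennreal c * (\<Sum>k=1..N. g (a, x k)) \<partial>?\<mu>)"
    by (simp add: nn_integral_dirac_sum[OF x gx])
  also have "\<dots> = ennreal c * (\<Sum>i=1..N. ennreal c * (\<Sum>k=1..N. g (x i, x k)))"
    using measurable_compose[OF measurable_Pair2' g]
    by (intro nn_integral_dirac_sum[OF x] measurable_restrict_space1 borel_measurable_times_ennreal
        borel_measurable_sum) auto
  \<comment> \<open>By injectivity the diagonal is met only for i = k, and there both g and the real
    quotient are 0.\<close>
  also have "\<dots> = ennreal c * (\<Sum>i=1..N. ennreal c * (\<Sum>k=1..N. ennreal (1 / norm (x i - x k))))"
    using inj by (intro arg_cong2[of _ _ _ _ "(*)"] sum.cong refl)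
      (auto simp: g_def coulomb_eq inj_on_eq_iff)
  also have "\<dots> = ennreal (c\<^sup>2 * (\<Sum>i=1..N. \<Sum>k=1..N. 1 / norm (x i - x k)))"
    using c by (simp add: sum_ennreal ennreal_mult'[symmetric] sum_nonneg power2_eq_square
        sum_distrib_left mult.assoc)
  finally show ?thesis
    unfolding repulsion_def using c by (simp add: enn2ereal_ennreal sum_nonneg)
qed

section \<open>Convergence of double integrals\<close>

text \<open>The elementary part of Arzela-Ascoli: convergence at the points of a finite net spreads
  to all of K by the common Lipschitz constant.\<close>

lemma Lipschitz_pointwise_imp_uniform_limit:
  fixes h :: "nat \<Rightarrow> 'a::euclidean_space \<Rightarrow> real"
  assumes "compact K" and L: "L \<ge> 0"
    and h: "\<And>j x y. \<bar>h j x - h j y\<bar> \<le> L * norm (x - y)"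
    and h0: "\<And>x y. \<bar>h0 x - h0 y\<bar> \<le> L * norm (x - y)"
    and lim: "\<And>x. (\<lambda>j. h j x) \<longlonglongrightarrow> h0 x"
  shows "uniform_limit K h h0 sequentially"
proof (rule uniform_limitI)
  fix e :: real assume e: "e > 0"
  \<comment> \<open>With this mesh each of the two Lipschitz errors is below e/3. The 1 added to L
    keeps the quotient meaningful for L = 0.\<close>
  define \<rho> where "\<rho> = e / (3 * (L + 1))"
  have \<rho>: "\<rho> > 0" "L * \<rho> < e / 3" using L e by (auto simp: \<rho>_def field_simps)
  obtain S where S: "finite S" "K \<subseteq> (\<Union>s\<in>S. ball s \<rho>)"
    using assms(1) \<rho>(1) unfolding compact_eq_totally_bounded by blast
  have "\<forall>\<^sub>F j in sequentially. \<forall>s\<in>S. dist (h j s) (h0 s) < e / 3"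
    using S(1) e by (intro eventually_ball_finite ballI tendstoD[OF lim]) auto
  then show "\<forall>\<^sub>F j in sequentially. \<forall>x\<in>K. dist (h j x) (h0 x) < e"
  proof (rule eventually_mono, safe)
    fix j x assume j: "\<forall>s\<in>S. dist (h j s) (h0 s) < e / 3" and "x \<in> K"
    then obtain s where s: "s \<in> S" "norm (x - s) < \<rho>"
      using S(2) by (auto simp: dist_norm norm_minus_commute)
    then have "L * norm (x - s) < e / 3" using \<rho>(2) L mult_left_mono[of "norm (x - s)" \<rho> L] by linarith
    then show "dist (h j x) (h0 x) < e"
      using h[of j x s] h0[of x s] bspec[OF j s(1)] unfolding dist_real_def by linarith
  qed
qed

definition soft_potential :: "real \<Rightarrow> 'a::real_normed_vector measure \<Rightarrow> 'a \<Rightarrow> real" where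
  "soft_potential \<delta> \<mu> x = (\<integral>y. soft_coulomb \<delta> x y \<partial>\<mu>)"

text \<open>Only the outer variable is cut off: for fixed x the inner integrand already vanishes at
  infinity and is a test function.\<close>

definition soft_energy :: "real \<Rightarrow> real \<Rightarrow> 'a::real_normed_vector measure \<Rightarrow> real" where
  "soft_energy r \<delta> \<mu> = (\<integral>x. cutoff r x * soft_potential \<delta> \<mu> x \<partial>\<mu>)"

lemma soft_potential_Lipschitz:
  fixes F :: "'a::euclidean_space set"
  assumes "closed F" "\<mu> \<in> radon_measures_pos F" "\<delta> > 0"
  shows "\<bar>soft_potential \<delta> \<mu> x - soft_potential \<delta> \<mu> x'\<bar> \<le> measure \<mu> F / \<delta>\<^sup>2 * norm (x - x')"
proof -
  interpret finite_measure \<mu> using finite_measure_radon[OF assms(2)] .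
  have i: "integrable \<mu> (soft_coulomb \<delta> x)" for x
    by (rule integrable_C0[OF assms(1) C0_soft_coulomb[OF assms(3)] assms(2)])
  have "\<bar>soft_potential \<delta> \<mu> x - soft_potential \<delta> \<mu> x'\<bar> =
      \<bar>\<integral>y. soft_coulomb \<delta> x y - soft_coulomb \<delta> x' y \<partial>\<mu>\<bar>"
    by (simp add: soft_potential_def i)
  also have "\<dots> \<le> (\<integral>y. \<bar>soft_coulomb \<delta> x y - soft_coulomb \<delta> x' y\<bar> \<partial>\<mu>)"
    by (rule integral_abs_bound)
  also have "\<dots> \<le> (\<integral>y. norm (x - x') / \<delta>\<^sup>2 \<partial>\<mu>)"
    using soft_coulomb_Lipschitz[OF assms(3)]
    by (intro integral_mono) (auto intro!: integrable_abs Bochner_Integration.integrable_diff i)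
  finally show ?thesis by (simp add: space_radon[OF assms(2)])
qed

lemma soft_potential_nonneg:
  assumes "\<delta> > 0"
  shows "0 \<le> soft_potential \<delta> \<mu> x"
  unfolding soft_potential_def
  by (intro integral_nonneg_AE AE_I2 soft_coulomb_bounds assms)

lemma continuous_on_soft_potential:
  fixes F :: "'a::euclidean_space set"
  assumes "closed F" "\<mu> \<in> radon_measures_pos F" "\<delta> > 0"
  shows "continuous_on S (soft_potential \<delta> \<mu>)"
proof (rule lipschitz_on_continuous_on[OF lipschitz_onI])
  show "dist (soft_potential \<delta> \<mu> x) (soft_potential \<delta> \<mu> y) \<le> measure \<mu> F / \<delta>\<^sup>2 * dist x y" for x y
    using soft_potential_Lipschitz[OF assms] by (simp add: dist_norm)
qed simp

text \<open>Turns continuous functions of unknown behaviour at infinity, such as potentials, into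
  test functions.\<close>

lemma C0_cutoff_times:
  assumes "continuous_on F f"
  shows "(\<lambda>x. cutoff r x * f x) \<in> C0 F"
  unfolding C0_iff
proof (intro conjI allI impI exI[of _ "r + 1"] ballI)
  show "continuous_on F (\<lambda>x. cutoff r x * f x)"
    by (intro continuous_intros continuous_on_cutoff assms)
qed (auto simp: cutoff_zero)

text \<open>Both the potential and the measure it is integrated against vary with j. Replacing the
  potential by its limit costs little, because the potentials converge uniformly on the support of
  the cutoff and the masses are bounded. What remains is the integral of one fixed test
  function.\<close>

lemma soft_energy_tendsto:
  fixes F :: "'a::euclidean_space set"
  assumes F: "closed F" and \<mu>s: "\<And>j. \<mu>s j \<in> radon_measures_pos F" and \<mu>: "\<mu> \<in> radon_measures_pos F"
    and lim: "\<And>f. f \<in> C0 F \<Longrightarrow> (\<lambda>j. \<integral>x. f x \<partial>\<mu>s j) \<longlonglongrightarrow> (\<integral>x. f x \<partial>\<mu>)"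
    and C: "\<And>j. measure (\<mu>s j) F \<le> C" and \<delta>: "\<delta> > 0"
  shows "(\<lambda>j. soft_energy r \<delta> (\<mu>s j)) \<longlonglongrightarrow> soft_energy r \<delta> \<mu>"
proof -
  \<comment> \<open>Including the mass of the limit gives all potentials, the limiting one too, a
    common Lipschitz constant.\<close>
  define C' where "C' = max C (measure \<mu> F)"
  have C': "measure (\<mu>s j) F \<le> C'" "measure \<mu> F \<le> C'" "C' \<ge> 0" for j
    using C[of j] by (auto simp: C'_def intro: order_trans[OF measure_nonneg] max.coboundedI2)
  let ?h = "\<lambda>j. soft_potential \<delta> (\<mu>s j)" and ?g = "soft_potential \<delta> \<mu>"
  have Lip: "\<bar>soft_potential \<delta> \<nu> x - soft_potential \<delta> \<nu> y\<bar> \<le> C' / \<delta>\<^sup>2 * norm (x - y)"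
    if "\<nu> \<in> radon_measures_pos F" "measure \<nu> F \<le> C'" for \<nu> x y
    using soft_potential_Lipschitz[OF F that(1) \<delta>, of x y] that(2) \<delta>
    by (meson divide_right_mono mult_right_mono norm_ge_zero order_trans zero_le_power2)
  have unif: "uniform_limit (cball 0 (r + 1)) ?h ?g sequentially"
    using C' Lip \<mu>s \<mu> lim[OF C0_soft_coulomb[OF \<delta>]]
    by (intro Lipschitz_pointwise_imp_uniform_limit[of _ "C' / \<delta>\<^sup>2"]) (auto simp: soft_potential_def)
  have i: "integrable \<nu> (\<lambda>x. cutoff r x * soft_potential \<delta> \<nu>' x)"
    if "\<nu> \<in> radon_measures_pos F" "\<nu>' \<in> radon_measures_pos F" for \<nu> \<nu>'
    by (rule integrable_C0[OF F C0_cutoff_times[OF continuous_on_soft_potential[OF F that(2) \<delta>]] that(1)])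
  have "(\<lambda>j. soft_energy r \<delta> (\<mu>s j) - (\<integral>x. cutoff r x * ?g x \<partial>\<mu>s j)) \<longlonglongrightarrow> 0"
  proof (rule tendstoI)
    fix e :: real assume e: "e > 0"
    define e' where "e' = e / (C' + 1)"
    have e': "e' > 0" "e' * C' < e" using e C'(3) by (auto simp: e'_def field_simps)
    show "\<forall>\<^sub>F j in sequentially.
        dist (soft_energy r \<delta> (\<mu>s j) - (\<integral>x. cutoff r x * ?g x \<partial>\<mu>s j)) 0 < e"
      using uniform_limitD[OF unif e'(1)]
    proof eventually_elim
      fix j assume j: "\<forall>x\<in>cball 0 (r + 1). dist (?h j x) (?g x) < e'"
      interpret finite_measure "\<mu>s j" using finite_measure_radon[OF \<mu>s] .
      have *: "\<bar>cutoff r x * ?h j x - cutoff r x * ?g x\<bar> \<le> e'" for x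
      proof (cases "norm x \<le> r + 1")
        case True
        then have "\<bar>?h j x - ?g x\<bar> \<le> e'" using j by (auto simp: dist_real_def intro: less_imp_le)
        then have "cutoff r x * \<bar>?h j x - ?g x\<bar> \<le> 1 * e'"
          using cutoff_bounds by (intro mult_mono) auto
        then show ?thesis
          using cutoff_bounds by (simp add: abs_mult abs_of_nonneg[OF cutoff_bounds(1)] flip: right_diff_distrib)
      qed (use e' in \<open>simp add: cutoff_zero\<close>)
      have "\<bar>soft_energy r \<delta> (\<mu>s j) - (\<integral>x. cutoff r x * ?g x \<partial>\<mu>s j)\<bar> =
          \<bar>\<integral>x. cutoff r x * ?h j x - cutoff r x * ?g x \<partial>\<mu>s j\<bar>"
        by (simp add: soft_energy_def i \<mu> \<mu>s)
      also have "\<dots> \<le> (\<integral>x. \<bar>cutoff r x * ?h j x - cutoff r x * ?g x\<bar> \<partial>\<mu>s j)"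
        by (rule integral_abs_bound)
      also have "\<dots> \<le> (\<integral>x. e' \<partial>\<mu>s j)"
        using * by (intro integral_mono) (auto intro!: integrable_abs Bochner_Integration.integrable_diff i \<mu> \<mu>s)
      also have "\<dots> = e' * measure (\<mu>s j) F" by (simp add: space_radon[OF \<mu>s])
      also have "\<dots> \<le> e' * C'" using C'(1) e' by (intro mult_left_mono) auto
      finally show "dist (soft_energy r \<delta> (\<mu>s j) - (\<integral>x. cutoff r x * ?g x \<partial>\<mu>s j)) 0 < e"
        using e' by simp
    qed
  qed
  from tendsto_add[OF this lim[OF C0_cutoff_times[OF continuous_on_soft_potential[OF F \<mu> \<delta>]], of r]]
  show ?thesis by (simp add: soft_energy_def)
qed

text \<open>Tonelli links the iterated real integral, which suits weak* limits, to a double integral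
  of the kind that occurs in \<open>repulsion\<close>.\<close>

lemma nn_integral_soft_energy:
  fixes F :: "'a::euclidean_space set"
  assumes F: "closed F" and \<mu>: "\<mu> \<in> radon_measures_pos F" and \<delta>: "\<delta> > 0"
  shows "(\<integral>\<^sup>+p. ennreal (cutoff r (fst p) * soft_coulomb \<delta> (fst p) (snd p)) \<partial>(\<mu> \<Otimes>\<^sub>M \<mu>)) =
    ennreal (soft_energy r \<delta> \<mu>)"
proof -
  interpret finite_measure \<mu> using finite_measure_radon[OF \<mu>] .
  have "(\<lambda>p::'a \<times> 'a. ennreal (cutoff r (fst p) * soft_coulomb \<delta> (fst p) (snd p)))
      \<in> borel_measurable (borel \<Otimes>\<^sub>M borel)" by measurable
  from nn_integral_fst[OF measurable_pair_radon[OF \<mu> this]]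
  have "(\<integral>\<^sup>+p. ennreal (cutoff r (fst p) * soft_coulomb \<delta> (fst p) (snd p)) \<partial>(\<mu> \<Otimes>\<^sub>M \<mu>)) =
      (\<integral>\<^sup>+x. \<integral>\<^sup>+y. ennreal (cutoff r x * soft_coulomb \<delta> x y) \<partial>\<mu> \<partial>\<mu>)" by simp
  also have "\<dots> = (\<integral>\<^sup>+x. ennreal (cutoff r x * soft_potential \<delta> \<mu> x) \<partial>\<mu>)"
    using cutoff_bounds soft_coulomb_bounds(1)[OF \<delta>] integrable_C0[OF F C0_soft_coulomb[OF \<delta>] \<mu>]
    by (intro nn_integral_cong, subst nn_integral_eq_integral) (auto simp: soft_potential_def intro!: AE_I2 mult_nonneg_nonneg)
  also have "\<dots> = ennreal (soft_energy r \<delta> \<mu>)"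
    unfolding soft_energy_def
    using cutoff_bounds soft_potential_nonneg[OF \<delta>]
      integrable_C0[OF F C0_cutoff_times[OF continuous_on_soft_potential[OF F \<mu> \<delta>]] \<mu>]
    by (intro nn_integral_eq_integral) (auto intro!: AE_I2 mult_nonneg_nonneg)
  finally show ?thesis .
qed

text \<open>One index n drives both the growing cutoff radius and the growing cap. Off the diagonal
  the sequence is eventually constant; on the diagonal it eventually equals n + 1, which matches the
  value infinity of \<open>coulomb\<close>.\<close>

lemma cutoff_soft_coulomb_tendsto:
  "(\<lambda>n. ennreal (cutoff (real n) x * soft_coulomb (1 / (real n + 1)) x y)) \<longlonglongrightarrow> coulomb x y"
proof -
  have x: "\<forall>\<^sub>F n in sequentially. norm x \<le> real n"
    using filterlim_real_sequentially by (auto simp: filterlim_at_top)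
  show ?thesis
  proof (cases "x = y")
    case True
    have "(\<lambda>n. of_nat (Suc n)) \<longlonglongrightarrow> (top::ennreal)"
      by (rule LIMSEQ_Suc[OF of_nat_tendsto_top_ennreal])
    moreover have "\<forall>\<^sub>F n in sequentially. of_nat (Suc n) =
        ennreal (cutoff (real n) x * soft_coulomb (1 / (real n + 1)) x y)"
      using x
    proof eventually_elim
      fix n assume "norm x \<le> real n"
      then have "cutoff (real n) x * soft_coulomb (1 / (real n + 1)) x y = real (Suc n)"
        by (simp add: True cutoff_one soft_coulomb_def max_def)
      then show "of_nat (Suc n) = ennreal (cutoff (real n) x * soft_coulomb (1 / (real n + 1)) x y)"
        by (metis ennreal_of_nat_eq_real_of_nat)
    qed
    ultimately show ?thesis
      unfolding True coulomb_diag infinity_ennreal_def by (rule Lim_transform_eventually)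
  next
    case False
    have "\<forall>\<^sub>F n in sequentially. inverse (real (Suc n)) < norm (x - y)"
      using False LIMSEQ_inverse_real_of_nat by (intro order_tendstoD) auto
    with x have "\<forall>\<^sub>F n in sequentially. ennreal (1 / norm (x - y)) =
        ennreal (cutoff (real n) x * soft_coulomb (1 / (real n + 1)) x y)"
    proof eventually_elim
      fix n assume "norm x \<le> real n" and n: "inverse (real (Suc n)) < norm (x - y)"
      moreover have "max (1 / (real n + 1)) (norm (x - y)) = norm (x - y)"
        using n by (simp add: inverse_eq_divide max_def add.commute)
      ultimately show "ennreal (1 / norm (x - y)) =
          ennreal (cutoff (real n) x * soft_coulomb (1 / (real n + 1)) x y)"
        by (simp add: cutoff_one soft_coulomb_def)
    qed
    then show ?thesis
      unfolding coulomb_eq[OF False] by (rule Lim_transform_eventually[OF tendsto_const])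
  qed
qed

text \<open>The domain of integration contains the diagonal, where the approximating kernels tend to
  infinity. A bound uniform in n therefore also excludes atoms of the measure.\<close>

lemma repulsion_leI:
  fixes F :: "'a::euclidean_space set"
  assumes F: "closed F" and \<mu>: "\<mu> \<in> radon_measures_pos F"
    and le: "\<And>n. soft_energy (real n) (1 / (real n + 1)) \<mu> \<le> c"
  shows "repulsion (F \<times> F) \<mu> \<le> ereal c"
proof -
  let ?k = "\<lambda>n p. ennreal (cutoff (real n) (fst p) * soft_coulomb (1 / (real n + 1)) (fst p) (snd p))"
  \<comment> \<open>The sign of c has to be known, because \<open>ennreal c\<close> would turn a
    negative c into 0.\<close>
  have "0 \<le> soft_energy (real 0) (1 / (real 0 + 1)) \<mu>"
    unfolding soft_energy_def
    by (intro integral_nonneg_AE AE_I2 mult_nonneg_nonneg cutoff_bounds soft_potential_nonneg) simp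
  with le[of 0] have c: "c \<ge> 0" by linarith
  have "(\<lambda>p::'a \<times> 'a. ?k n p) \<in> borel_measurable (borel \<Otimes>\<^sub>M borel)" for n by measurable
  then have k: "?k n \<in> borel_measurable (\<mu> \<Otimes>\<^sub>M \<mu>)" for n
    by (rule measurable_pair_radon[OF \<mu>])
  have "(\<integral>\<^sup>+p\<in>F \<times> F. coulomb (fst p) (snd p) \<partial>(\<mu> \<Otimes>\<^sub>M \<mu>)) =
      (\<integral>\<^sup>+p. liminf (\<lambda>n. ?k n p) \<partial>(\<mu> \<Otimes>\<^sub>M \<mu>))"
    by (intro nn_integral_cong)
       (auto simp: space_pair_measure space_radon[OF \<mu>] lim_imp_Liminf[OF _ cutoff_soft_coulomb_tendsto])
  also have "\<dots> \<le> liminf (\<lambda>n. \<integral>\<^sup>+p. ?k n p \<partial>(\<mu> \<Otimes>\<^sub>M \<mu>))"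
    by (rule nn_integral_liminf[OF k])
  also have "\<dots> \<le> liminf (\<lambda>n. ennreal c)"
    by (intro Liminf_mono always_eventually allI)
       (simp add: nn_integral_soft_energy[OF F \<mu>] ennreal_leI le)
  also have "\<dots> = ennreal c" by (simp add: Liminf_const)
  finally show ?thesis
    using c unfolding repulsion_def by (metis enn2ereal_ennreal less_eq_ennreal.rep_eq)
qed

text \<open>Off the diagonal the cap and the cutoff only decrease the interaction. The last term is
  the price of the N self-interactions, each at most 1/\<delta>.\<close>

lemma soft_energy_dirac_sum_le:
  fixes F :: "'a::euclidean_space set"
  assumes x: "x ` {1..N} \<subseteq> F" and inj: "inj_on x {1..N}" and c: "c \<ge> 0" and \<delta>: "\<delta> > 0"
  shows "soft_energy r \<delta> (dirac_sum F c N x) \<le>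
    c\<^sup>2 * (\<Sum>i=1..N. \<Sum>k=1..N. 1 / norm (x i - x k)) + c\<^sup>2 * real N / \<delta>"
proof -
  let ?\<mu> = "dirac_sum F c N x"
  have "soft_coulomb \<delta> a \<in> borel_measurable (restrict_space borel F)" for a
    by (intro borel_measurable_continuous_on_restrict continuous_on_soft_coulomb \<delta>)
  then have pot: "soft_potential \<delta> ?\<mu> = (\<lambda>a. c * (\<Sum>k=1..N. soft_coulomb \<delta> a (x k)))"
    unfolding soft_potential_def by (simp add: integral_dirac_sum[OF x _ c])
  have [measurable]: "(\<lambda>a. soft_coulomb \<delta> a b) \<in> borel_measurable borel" for b :: 'a
    unfolding soft_coulomb_def by measurable
  have "soft_energy r \<delta> ?\<mu> = c * (\<Sum>i=1..N. cutoff r (x i) * (c * (\<Sum>k=1..N. soft_coulomb \<delta> (x i) (x k))))"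
    unfolding soft_energy_def pot
    by (intro integral_dirac_sum[OF x _ c] measurable_restrict_space1) measurable
  \<comment> \<open>The real quotient is 0 for i = k, so the cap must be added explicitly for these
    terms.\<close>
  also have "\<dots> \<le> c * (\<Sum>i=1..N. 1 * (c * (\<Sum>k=1..N. 1 / norm (x i - x k) + (if i = k then 1 / \<delta> else 0))))"
    using c inj cutoff_bounds soft_coulomb_bounds[OF \<delta>]
    by (intro mult_left_mono sum_mono mult_mono mult_nonneg_nonneg sum_nonneg)
       (auto simp: inj_on_eq_iff intro!: soft_coulomb_bounds(3)[OF \<delta>])
  also have "\<dots> = c\<^sup>2 * (\<Sum>i=1..N. \<Sum>k=1..N. 1 / norm (x i - x k)) + c\<^sup>2 * real N / \<delta>"
    by (simp add: sum.distrib power2_eq_square algebra_simps flip: sum_distrib_left)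
  finally show ?thesis .
qed

section \<open>The lower bound\<close>

text \<open>Tested with cutoffs, mass can be lost in the limit but not created. The bound is asked
  for infinitely many j only, because point-mass configurations may occur along a mere
  subsequence.\<close>

lemma measure_le_if_frequently:
  fixes F :: "'a::euclidean_space set"
  assumes \<mu>s: "\<And>j. \<mu>s j \<in> radon_measures_pos F" and \<mu>: "\<mu> \<in> radon_measures_pos F"
    and F: "closed F"
    and lim: "\<And>f. f \<in> C0 F \<Longrightarrow> (\<lambda>j. \<integral>x. f x \<partial>\<mu>s j) \<longlonglongrightarrow> (\<integral>x. f x \<partial>\<mu>)"
    and q: "q \<longlonglongrightarrow> \<Lambda>" and freq: "\<exists>\<^sub>F j in sequentially. measure (\<mu>s j) F \<le> q j"
  shows "measure \<mu> F \<le> \<Lambda>"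
proof (rule LIMSEQ_le_const2)
  interpret finite_measure \<mu> using finite_measure_radon[OF \<mu>] .
  have cut: "cutoff r \<in> C0 F" for r
    using C0_cutoff_times[of F "\<lambda>_. 1" r] by (simp add: continuous_on_const)
  show "\<exists>N. \<forall>n\<ge>N. (\<integral>x. cutoff (real n) x \<partial>\<mu>) \<le> \<Lambda>"
  proof (intro exI allI impI leI notI)
    fix n assume "\<Lambda> < (\<integral>x. cutoff (real n) x \<partial>\<mu>)"
    then have "\<forall>\<^sub>F j in sequentially. 0 < (\<integral>x. cutoff (real n) x \<partial>\<mu>s j) - q j"
      by (intro order_tendstoD[OF tendsto_diff[OF lim[OF cut] q]]) simp
    then have "\<exists>\<^sub>F j in sequentially. False"
    proof (rule frequently_rev_mp[OF freq eventually_mono], safe)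
      fix j assume j: "0 < (\<integral>x. cutoff (real n) x \<partial>\<mu>s j) - q j" "measure (\<mu>s j) F \<le> q j"
      interpret j: finite_measure "\<mu>s j" using finite_measure_radon[OF \<mu>s] .
      have "(\<integral>x. cutoff (real n) x \<partial>\<mu>s j) \<le> (\<integral>x. 1 \<partial>\<mu>s j)"
        by (intro integral_mono integrable_C0[OF F cut \<mu>s] cutoff_bounds) simp
      with j show False by (simp add: space_radon[OF \<mu>s])
    qed
    then show False by simp
  qed
  have "(\<lambda>n. \<integral>x. cutoff (real n) x \<partial>\<mu>) \<longlonglongrightarrow> (\<integral>x. 1 \<partial>\<mu>)"
  proof (rule integral_dominated_convergence[where w = "\<lambda>_. 1"])
    show "AE x in \<mu>. (\<lambda>n. cutoff (real n) x) \<longlonglongrightarrow> 1"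
    proof (rule AE_I2)
      fix x :: 'a
      have "\<forall>\<^sub>F n in sequentially. norm x \<le> real n"
        using filterlim_real_sequentially by (auto simp: filterlim_at_top)
      then have "\<forall>\<^sub>F n in sequentially. cutoff (real n) x = 1"
        by eventually_elim (rule cutoff_one)
      then show "(\<lambda>n. cutoff (real n) x) \<longlonglongrightarrow> 1" by (rule tendsto_eventually)
    qed
  qed (auto simp: abs_of_nonneg[OF cutoff_bounds(1)] cutoff_bounds(2)
      intro!: measurable_radon[OF \<mu>])
  then show "(\<lambda>n. \<integral>x. cutoff (real n) x \<partial>\<mu>) \<longlonglongrightarrow> measure \<mu> F"
    by (simp add: space_radon[OF \<mu>])
qed

lemma closed_exterior: "closed (exterior M R d)"
  unfolding exterior_def by (intro closed_Diff closed_UNIV open_UN ballI open_ball)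

lemma inverse_dist_C0_exterior:
  assumes "d > 0" "\<alpha> \<in> {1..M}"
  shows "(\<lambda>x. 1 / norm (x - R \<alpha>)) \<in> C0 (exterior M R d)"
  using assms(2)
  by (intro C0_inverse_dist[OF assms(1)]) (force simp: exterior_def dist_norm norm_minus_commute)

lemma attraction_eq_sum:
  assumes "d > 0" "\<mu> \<in> radon_measures_pos (exterior M R d)"
  shows "attraction M R w \<mu> = (\<Sum>\<alpha>=1..M. w \<alpha> * (\<integral>x. 1 / norm (x - R \<alpha>) \<partial>\<mu>))"
  unfolding attraction_def
  by (subst Bochner_Integration.integral_sum)
     (auto intro!: integrable_mult_right integrable_C0[OF closed_exterior inverse_dist_C0_exterior assms(2)]
       assms(1) simp del: times_divide_eq_right)

text \<open>The exterior domain stays at distance d from the nuclei, so every summand of the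
  attraction is a continuous function vanishing at infinity. The attraction is thus a continuous
  perturbation, and only the repulsion is delicate.\<close>

lemma attraction_tendsto:
  assumes d: "d > 0"
    and \<mu>s: "\<And>j. \<mu>s j \<in> radon_measures_pos (exterior M R d)"
    and \<mu>: "\<mu> \<in> radon_measures_pos (exterior M R d)"
    and lim: "\<And>f. f \<in> C0 (exterior M R d) \<Longrightarrow> (\<lambda>j. \<integral>x. f x \<partial>\<mu>s j) \<longlonglongrightarrow> (\<integral>x. f x \<partial>\<mu>)"
    and w: "\<And>\<alpha>. \<alpha> \<in> {1..M} \<Longrightarrow> (\<lambda>j. w j \<alpha>) \<longlonglongrightarrow> z \<alpha>"
  shows "(\<lambda>j. attraction M R (w j) (\<mu>s j)) \<longlonglongrightarrow> attraction M R z \<mu>"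
  unfolding attraction_eq_sum[OF d \<mu>s] attraction_eq_sum[OF d \<mu>]
  by (intro tendsto_sum tendsto_mult w lim inverse_dist_C0_exterior d)

lemma V_tilde_dirac_sum:
  assumes "x ` {1..N} \<subseteq> exterior M R d" "inj_on x {1..N}" "(\<Sum>\<alpha>=1..M. Z \<alpha>) > 0"
  shows "V_tilde M R d N Z (dirac_sum (exterior M R d) (1 / (\<Sum>\<alpha>=1..M. Z \<alpha>)) N x) =
    ereal (- attraction M R (\<lambda>\<alpha>. Z \<alpha> / (\<Sum>\<beta>=1..M. Z \<beta>))
             (dirac_sum (exterior M R d) (1 / (\<Sum>\<alpha>=1..M. Z \<alpha>)) N x)
           + 1/2 * ((1 / (\<Sum>\<alpha>=1..M. Z \<alpha>))\<^sup>2 * (\<Sum>i=1..N. \<Sum>k=1..N. 1 / norm (x i - x k))))"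
proof -
  have "\<exists>y. inj_on y {1..N} \<and> y ` {1..N} \<subseteq> exterior M R d \<and>
      dirac_sum (exterior M R d) (1 / (\<Sum>\<alpha>=1..M. Z \<alpha>)) N x =
      dirac_sum (exterior M R d) (1 / (\<Sum>\<alpha>=1..M. Z \<alpha>)) N y"
    using assms by blast
  then show ?thesis
    using repulsion_dirac_sum[OF assms(1,2), of "1 / (\<Sum>\<alpha>=1..M. Z \<alpha>)"] assms(3)
    unfolding V_tilde_def Let_def by (simp del: of_nat_Suc)
qed

lemma I_limit_le_liminf_V_tilde:
  fixes R :: "nat \<Rightarrow> real^3" and M :: nat and d :: real and Z :: "nat \<Rightarrow> nat \<Rightarrow> real"
  defines "F \<equiv> exterior M R d" and "W \<equiv> \<lambda>j. \<Sum>\<alpha>=1..M. Z j \<alpha>"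
  assumes d: "d > 0" and W: "\<And>j. W j > 0" "filterlim W at_top sequentially"
    and q: "(\<lambda>j. real (N j) / W j) \<longlonglongrightarrow> \<Lambda>"
    and z: "\<And>\<alpha>. \<alpha> \<in> {1..M} \<Longrightarrow> (\<lambda>j. Z j \<alpha> / W j) \<longlonglongrightarrow> z \<alpha>"
    and \<mu>s: "\<And>j. \<mu>s j \<in> radon_measures_pos F" and \<mu>: "\<mu> \<in> radon_measures_pos F"
    and lim: "\<And>f. f \<in> C0 F \<Longrightarrow> (\<lambda>j. \<integral>x. f x \<partial>\<mu>s j) \<longlonglongrightarrow> (\<integral>x. f x \<partial>\<mu>)"
  shows "I_limit M R d \<Lambda> z \<mu> \<le> liminf (\<lambda>j. V_tilde M R d (N j) (Z j) (\<mu>s j))"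
proof -
  let ?V = "\<lambda>j. V_tilde M R d (N j) (Z j) (\<mu>s j)"
  define fin where "fin j \<longleftrightarrow> (\<exists>x. inj_on x {1..N j} \<and> x ` {1..N j} \<subseteq> F \<and>
    \<mu>s j = dirac_sum F (1 / W j) (N j) x)" for j
  have F: "closed F" unfolding F_def by (rule closed_exterior)
  have V_inf: "?V j = \<infinity>" if "\<not> fin j" for j
    using that unfolding fin_def V_tilde_def F_def W_def Let_def by (rule if_not_P)
  have mass: "measure (\<mu>s j) F = real (N j) / W j" if "fin j" for j
    using that W(1)[of j] unfolding fin_def by (auto simp: measure_dirac_sum_space)
  show ?thesis
  proof (cases "\<exists>\<^sub>F j in sequentially. fin j")
    case False
    then have "\<forall>\<^sub>F j in sequentially. ?V j = \<infinity>"
      unfolding not_frequently by eventually_elim (rule V_inf)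
    then have "liminf ?V = \<infinity>"
      by (intro lim_imp_Liminf tendsto_eventually) auto
    then show ?thesis by simp
  next
    case True
    then have mass_le: "measure \<mu> F \<le> \<Lambda>"
      by (intro measure_le_if_frequently[OF \<mu>s \<mu> F lim q]) (auto elim!: frequently_elim1 simp: mass)
    \<comment> \<open>Where \<open>\<mu>s j\<close> is not a sum of point masses its mass is not
      controlled by N/Z. Substituting the limit there keeps the convergence and makes all masses
      uniformly bounded.\<close>
    define \<nu>s where "\<nu>s j = (if fin j then \<mu>s j else \<mu>)" for j
    have \<nu>s: "\<nu>s j \<in> radon_measures_pos F" for j by (simp add: \<nu>s_def \<mu>s \<mu>)
    have lim': "(\<lambda>j. \<integral>x. f x \<partial>\<nu>s j) \<longlonglongrightarrow> (\<integral>x. f x \<partial>\<mu>)" if "f \<in> C0 F" for f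
    proof (rule tendstoI)
      fix e :: real assume "e > 0"
      with tendstoD[OF lim[OF that] this]
      show "\<forall>\<^sub>F j in sequentially. dist (\<integral>x. f x \<partial>\<nu>s j) (\<integral>x. f x \<partial>\<mu>) < e"
        by (auto elim!: eventually_mono simp: \<nu>s_def)
    qed
    have "Bseq (\<lambda>j. real (N j) / W j)"
      using q by (intro convergent_imp_Bseq) (auto simp: convergent_def)
    then obtain B where "\<And>j. norm (real (N j) / W j) \<le> B" by (auto simp: Bseq_def)
    then have B: "real (N j) / W j \<le> B" for j by (metis abs_le_D1 real_norm_def)
    have C: "measure (\<nu>s j) F \<le> max B (measure \<mu> F)" for j
      using B[of j] by (auto simp: \<nu>s_def mass)
    \<comment> \<open>A real lower bound for the functional: the soft energy minus the
      self-interaction error for \<delta> = 1/(n + 1). The error is factored as N/W times 1/W so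
      that its limit 0 can be read off.\<close>
    define a where "a n j = - attraction M R (\<lambda>\<alpha>. Z j \<alpha> / W j) (\<nu>s j) +
      1/2 * (soft_energy (real n) (1 / (real n + 1)) (\<nu>s j) - real (N j) / W j * (1 / W j) * (real n + 1))"
      for n j
    have a_le: "ereal (a n j) \<le> ?V j" for n j
    proof (cases "fin j")
      case True
      then obtain x where x: "inj_on x {1..N j}" "x ` {1..N j} \<subseteq> F"
        "\<mu>s j = dirac_sum F (1 / W j) (N j) x" unfolding fin_def by blast
      have "soft_energy (real n) (1 / (real n + 1)) (\<mu>s j) \<le>
          (1 / W j)\<^sup>2 * (\<Sum>i=1..N j. \<Sum>k=1..N j. 1 / norm (x i - x k))
          + (1 / W j)\<^sup>2 * real (N j) / (1 / (real n + 1))"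
        unfolding x(3) using W(1)[of j] by (intro soft_energy_dirac_sum_le x) auto
      also have "(1 / W j)\<^sup>2 * real (N j) / (1 / (real n + 1)) = real (N j) / W j * (1 / W j) * (real n + 1)"
        by (simp add: power2_eq_square)
      finally have "a n j \<le> - attraction M R (\<lambda>\<alpha>. Z j \<alpha> / W j) (\<mu>s j) +
          1/2 * ((1 / W j)\<^sup>2 * (\<Sum>i=1..N j. \<Sum>k=1..N j. 1 / norm (x i - x k)))"
        using True by (simp add: a_def \<nu>s_def)
      also have "ereal \<dots> = ?V j"
        using V_tilde_dirac_sum[of x "N j" M R d "Z j"] x W(1)[of j] unfolding F_def W_def by simp
      finally show ?thesis by simp
    qed (simp add: V_inf)
    have a_lim: "(\<lambda>j. a n j) \<longlonglongrightarrow> - attraction M R z \<mu> +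
        1/2 * (soft_energy (real n) (1 / (real n + 1)) \<mu> - \<Lambda> * 0 * (real n + 1))" for n
      unfolding a_def
      by (intro tendsto_intros q z real_tendsto_divide_at_top[OF tendsto_const W(2)]
          attraction_tendsto[OF d \<nu>s[unfolded F_def] \<mu>[unfolded F_def] lim'[unfolded F_def]]
          soft_energy_tendsto[OF F \<nu>s \<mu> lim' C]) auto
    \<comment> \<open>Here j tends to infinity with n fixed. The bound then holds for every n, and
      \<open>repulsion_leI\<close> lets n grow afterwards.\<close>
    have le: "ereal (- attraction M R z \<mu> + 1/2 * soft_energy (real n) (1 / (real n + 1)) \<mu>) \<le> liminf ?V"
      for n
    proof -
      have "ereal (- attraction M R z \<mu> + 1/2 * soft_energy (real n) (1 / (real n + 1)) \<mu>) =
          liminf (\<lambda>j. ereal (a n j))"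
        using a_lim[of n] by (intro lim_imp_Liminf[symmetric]) auto
      also have "\<dots> \<le> liminf ?V"
        by (intro Liminf_mono always_eventually allI a_le)
      finally show ?thesis .
    qed
    show ?thesis
    proof (cases "liminf ?V")
      case (real c)
      have "soft_energy (real n) (1 / (real n + 1)) \<mu> \<le> 2 * (c + attraction M R z \<mu>)" for n
        using le[of n] unfolding real by simp
      from repulsion_leI[OF F \<mu> this]
      have "ereal (1/2) * repulsion (F \<times> F) \<mu> \<le> ereal (1/2) * ereal (2 * (c + attraction M R z \<mu>))"
        by (intro ereal_mult_left_mono) auto
      then have "- ereal (attraction M R z \<mu>) + ereal (1/2) * repulsion (F \<times> F) \<mu> \<le>
          - ereal (attraction M R z \<mu>) + ereal (c + attraction M R z \<mu>)"
        by (intro add_left_mono) (simp add: add_divide_distrib)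
      then show ?thesis
        unfolding real I_limit_def Let_def using mass_le by (simp add: F_def)
    next
      case MInf
      then show ?thesis using le[of 0] by simp
    qed simp
  qed
qed

section \<open>Random sampling\<close>

text \<open>The probabilistic method in its basic form: a bound on an expectation is turned into one
  actual sample.\<close>

lemma (in prob_space) exists_le_nn_integral:
  assumes [measurable]: "X \<in> borel_measurable M" and le: "(\<integral>\<^sup>+\<omega>. X \<omega> \<partial>M) \<le> c"
  shows "\<exists>\<omega>\<in>space M. X \<omega> \<le> c"
proof (rule ccontr)
  assume *: "\<not> ?thesis"
  then have gt: "c < X \<omega>" if "\<omega> \<in> space M" for \<omega> using that by auto
  have "\<not> (AE \<omega> in M. X \<omega> \<le> c)"
  proof
    assume "AE \<omega> in M. X \<omega> \<le> c"
    then have "AE \<omega> in M. False" using AE_space by eventually_elim (metis gt not_less)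
    then show False by simp
  qed
  \<comment> \<open>Strict monotonicity of the integral needs a finite smaller side; c is finite
    because it lies strictly below a value of X.\<close>
  moreover have "c \<noteq> \<infinity>" using gt not_empty by fastforce
  ultimately have "(\<integral>\<^sup>+\<omega>. c \<partial>M) < (\<integral>\<^sup>+\<omega>. X \<omega> \<partial>M)"
    using gt by (intro nn_integral_less) (auto simp: emeasure_space_1 less_imp_le intro!: AE_I2)
  then show False using le by (simp add: emeasure_space_1)
qed

text \<open>A rectangle pulls back to a cylinder over {i, k}, whose measure is the product of the
  measures of its sides. This makes the expected interaction of two different sample points equal to
  the double integral over the sampled measure.\<close>

lemma (in prob_space) distr_PiM_pair:
  assumes "i \<in> I" "k \<in> I" "i \<noteq> k"
  shows "distr (PiM I (\<lambda>_. M)) (M \<Otimes>\<^sub>M M) (\<lambda>\<omega>. (\<omega> i, \<omega> k)) = M \<Otimes>\<^sub>M M"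
proof (rule pair_measure_eqI[symmetric])
  let ?P = "PiM I (\<lambda>_. M)"
  show "sigma_finite_measure M" "sigma_finite_measure M"
    by (rule sigma_finite_measure_axioms)+
  show "sets (M \<Otimes>\<^sub>M M) = sets (distr ?P (M \<Otimes>\<^sub>M M) (\<lambda>\<omega>. (\<omega> i, \<omega> k)))" by simp
  fix A B assume A: "A \<in> sets M" and B: "B \<in> sets M"
  have m: "(\<lambda>\<omega>. (\<omega> i, \<omega> k)) \<in> ?P \<rightarrow>\<^sub>M M \<Otimes>\<^sub>M M"
    using assms by (intro measurable_Pair) auto
  have "emeasure (distr ?P (M \<Otimes>\<^sub>M M) (\<lambda>\<omega>. (\<omega> i, \<omega> k))) (A \<times> B) =
      emeasure ?P ((\<lambda>\<omega>. (\<omega> i, \<omega> k)) -` (A \<times> B) \<inter> space ?P)"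
    using A B by (intro emeasure_distr[OF m]) auto
  also have "(\<lambda>\<omega>. (\<omega> i, \<omega> k)) -` (A \<times> B) \<inter> space ?P =
      prod_emb I (\<lambda>_. M) {i, k} (\<Pi>\<^sub>E l\<in>{i, k}. if l = i then A else B)"
    using assms by (auto simp: prod_emb_def space_PiM PiE_iff)
  also have "emeasure ?P \<dots> = (\<Prod>l\<in>{i, k}. emeasure M (if l = i then A else B))"
    using A B assms by (intro emeasure_PiM_emb) (auto simp: prob_space_axioms)
  also have "\<dots> = emeasure M A * emeasure M B" using assms(3) by simp
  finally show "emeasure M A * emeasure M B =
      emeasure (distr ?P (M \<Otimes>\<^sub>M M) (\<lambda>\<omega>. (\<omega> i, \<omega> k))) (A \<times> B)" ..
qed

text \<open>Two different coordinates are independent, so the integral factors and the centring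
  makes it 0. For i = k the integrand is the square of a number in [-1, 1].\<close>

lemma (in prob_space) PiM_pair_centered_indicator:
  assumes I: "i \<in> I" "k \<in> I" and A: "A \<in> events"
  shows "(\<integral>\<omega>. (indicator A (\<omega> i) - prob A) * (indicator A (\<omega> k) - prob A) \<partial>PiM I (\<lambda>_. M))
      \<le> (if i = k then 1 else 0)"
    and "integrable (PiM I (\<lambda>_. M)) (\<lambda>\<omega>. (indicator A (\<omega> i) - prob A) * (indicator A (\<omega> k) - prob A))"
proof -
  let ?P = "PiM I (\<lambda>_. M)" and ?h = "\<lambda>x. indicator A x - prob A :: real"
  interpret P: prob_space ?P by (intro prob_space_PiM prob_space_axioms)
  interpret MM: pair_prob_space M M ..
  have h1: "\<bar>?h x\<bar> \<le> 1" for x by (auto simp: indicator_def)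
  have h2: "\<bar>?h x * ?h y\<bar> \<le> 1" for x y
    using mult_mono[OF h1[of x] h1[of y]] by (simp add: abs_mult)
  have hm [measurable]: "?h \<in> borel_measurable M" using A by measurable
  show int: "integrable ?P (\<lambda>\<omega>. ?h (\<omega> i) * ?h (\<omega> k))"
    using I h2 by (intro P.integrable_const_bound[of _ 1]) auto
  show "(\<integral>\<omega>. ?h (\<omega> i) * ?h (\<omega> k) \<partial>?P) \<le> (if i = k then 1 else 0)"
  proof (cases "i = k")
    case True
    have "(\<integral>\<omega>. ?h (\<omega> i) * ?h (\<omega> k) \<partial>?P) \<le> (\<integral>\<omega>. 1 \<partial>?P)"
      using h2 by (intro integral_mono int) (auto simp: abs_le_iff)
    then show ?thesis using True by (simp add: P.prob_space)
  next
    case False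
    have "integrable (M \<Otimes>\<^sub>M M) (\<lambda>p. ?h (fst p) * ?h (snd p))"
      using h2 by (intro MM.P.integrable_const_bound[of _ 1]) auto
    then have "integrable (M \<Otimes>\<^sub>M M) (\<lambda>(x, y). ?h x * ?h y)" by (simp add: case_prod_beta')
    from MM.integral_fst'[OF this]
    have "(\<integral>p. (case p of (x, y) \<Rightarrow> ?h x * ?h y) \<partial>(M \<Otimes>\<^sub>M M)) = (\<integral>x. \<integral>y. ?h x * ?h y \<partial>M \<partial>M)"
      by simp
    also have "(\<integral>x. ?h x \<partial>M) = 0"
      using A by (subst Bochner_Integration.integral_diff) (auto simp: prob_space emeasure_eq_measure)
    then have "(\<integral>x. \<integral>y. ?h x * ?h y \<partial>M \<partial>M) = 0"
      by (simp only: integral_mult_right_zero mult_zero_right Bochner_Integration.integral_zero)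
    finally have "(\<integral>p. ?h (fst p) * ?h (snd p) \<partial>distr ?P (M \<Otimes>\<^sub>M M) (\<lambda>\<omega>. (\<omega> i, \<omega> k))) = 0"
      unfolding distr_PiM_pair[OF I False] by (simp add: case_prod_beta')
    moreover have "(\<lambda>\<omega>. (\<omega> i, \<omega> k)) \<in> ?P \<rightarrow>\<^sub>M M \<Otimes>\<^sub>M M"
      using I by (intro measurable_Pair) auto
    ultimately show ?thesis
      using False by (subst (asm) integral_distr) auto
  qed
qed

text \<open>Expanding the square gives n^2 covariances, of which only the n diagonal ones
  contribute, each at most 1; division by n^2 leaves 1/n.\<close>

lemma (in prob_space) PiM_variance_frequency_le:
  fixes n :: nat
  assumes n: "n \<ge> 1" and A: "A \<in> events"
  shows "(\<integral>\<^sup>+\<omega>. ennreal (((\<Sum>i=1..n. indicator A (\<omega> i)) / real n - prob A)\<^sup>2) \<partial>PiM {1..n} (\<lambda>_. M))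
    \<le> ennreal (1 / real n)"
proof -
  let ?P = "PiM {1..n} (\<lambda>_. M)" and ?h = "\<lambda>x. indicator A x - prob A :: real"
  have eq: "((\<Sum>i=1..n. indicator A (\<omega> i)) / real n - prob A)\<^sup>2 =
      (\<Sum>i=1..n. \<Sum>k=1..n. ?h (\<omega> i) * ?h (\<omega> k)) / (real n)\<^sup>2" for \<omega>
  proof -
    have "(\<Sum>i=1..n. indicator A (\<omega> i)) / real n - prob A = (\<Sum>i=1..n. ?h (\<omega> i)) / real n"
      using n by (simp add: sum_subtractf field_simps)
    then show ?thesis by (simp add: power_divide power2_eq_square sum_product)
  qed
  have int: "integrable ?P (\<lambda>\<omega>. (\<Sum>i=1..n. \<Sum>k=1..n. ?h (\<omega> i) * ?h (\<omega> k)) / (real n)\<^sup>2)"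
    by (intro integrable_divide Bochner_Integration.integrable_sum PiM_pair_centered_indicator(2) A)
  have "(\<integral>\<omega>. (\<Sum>i=1..n. \<Sum>k=1..n. ?h (\<omega> i) * ?h (\<omega> k)) \<partial>?P) =
      (\<Sum>i=1..n. (\<integral>\<omega>. (\<Sum>k=1..n. ?h (\<omega> i) * ?h (\<omega> k)) \<partial>?P))"
    by (intro Bochner_Integration.integral_sum Bochner_Integration.integrable_sum
        PiM_pair_centered_indicator(2) A)
  also have "\<dots> = (\<Sum>i=1..n. \<Sum>k=1..n. (\<integral>\<omega>. ?h (\<omega> i) * ?h (\<omega> k) \<partial>?P))"
    by (intro sum.cong refl Bochner_Integration.integral_sum PiM_pair_centered_indicator(2) A)
  finally have "(\<integral>\<omega>. (\<Sum>i=1..n. \<Sum>k=1..n. ?h (\<omega> i) * ?h (\<omega> k)) / (real n)\<^sup>2 \<partial>?P) =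
      (\<Sum>i=1..n. \<Sum>k=1..n. (\<integral>\<omega>. ?h (\<omega> i) * ?h (\<omega> k) \<partial>?P)) / (real n)\<^sup>2"
    by simp
  also have "\<dots> \<le> (\<Sum>i=1..n. \<Sum>k=1..n. if i = k then 1 else 0) / (real n)\<^sup>2"
    by (intro divide_right_mono sum_mono PiM_pair_centered_indicator(1) A) auto
  also have "\<dots> = 1 / real n" using n by (simp add: power2_eq_square)
  finally have le: "(\<integral>\<omega>. (\<Sum>i=1..n. \<Sum>k=1..n. ?h (\<omega> i) * ?h (\<omega> k)) / (real n)\<^sup>2 \<partial>?P) \<le> 1 / real n" .
  have nonneg: "0 \<le> (\<Sum>i=1..n. \<Sum>k=1..n. ?h (\<omega> i) * ?h (\<omega> k)) / (real n)\<^sup>2" for \<omega>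
    unfolding eq[symmetric] by simp
  show ?thesis
    unfolding eq nn_integral_eq_integral[OF int AE_I2[OF nonneg]]
    by (rule ennreal_leI[OF le])
qed

text \<open>Weighting the deviations by \<open>sqrt n\<close> forces them to zero, while the variance bound
  \<open>1 / n\<close> keeps the expectation of the weighted sum small.\<close>

lemma (in prob_space) exists_good_sample:
  fixes A :: "nat \<Rightarrow> 'a set" and n :: nat
  assumes g: "g \<in> borel_measurable (M \<Otimes>\<^sub>M M)" and A: "\<And>l. A l \<in> events" and n: "n \<ge> 1"
  obtains x where "x ` {1..n} \<subseteq> space M"
    "ennreal (1 / (real n)\<^sup>2) * (\<Sum>i=1..n. \<Sum>k=1..n. if i = k then 0 else g (x i, x k)) +
     ennreal (sqrt (real n)) * (\<Sum>l<n. ennreal ((1/2) ^ l) *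
       ennreal (((\<Sum>i=1..n. indicator (A l) (x i)) / real n - prob (A l))\<^sup>2))
     \<le> (\<integral>\<^sup>+p. g p \<partial>(M \<Otimes>\<^sub>M M)) + ennreal (2 / sqrt (real n))"
proof -
  let ?P = "PiM {1..n} (\<lambda>_. M)" and ?e = "\<integral>\<^sup>+p. g p \<partial>(M \<Otimes>\<^sub>M M)"
  let ?d = "\<lambda>l \<omega>. ennreal (((\<Sum>i=1..n. indicator (A l) (\<omega> i)) / real n - prob (A l))\<^sup>2)"
  let ?U = "\<lambda>\<omega>. \<Sum>i=1..n. \<Sum>k=1..n. if i = k then 0 else g (\<omega> i, \<omega> k)"
  interpret P: prob_space ?P by (intro prob_space_PiM prob_space_axioms)
  have pair: "(\<lambda>\<omega>. (\<omega> i, \<omega> k)) \<in> ?P \<rightarrow>\<^sub>M M \<Otimes>\<^sub>M M" if "i \<in> {1..n}" "k \<in> {1..n}" for i k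
    using that by (intro measurable_Pair measurable_component_singleton) auto
  have gm: "(\<lambda>\<omega>. if i = k then 0 else g (\<omega> i, \<omega> k)) \<in> borel_measurable ?P"
    if "i \<in> {1..n}" "k \<in> {1..n}" for i k
    using measurable_compose[OF pair[OF that] g] by simp
  have dm: "?d l \<in> borel_measurable ?P" for l
  proof -
    have "(\<lambda>\<omega>. indicator (A l) (\<omega> i) :: real) \<in> borel_measurable ?P" if "i \<in> {1..n}" for i
      using A that by (intro measurable_compose[OF measurable_component_singleton]) auto
    then show ?thesis
      by (intro measurable_compose[OF _ measurable_ennreal] borel_measurable_power
          borel_measurable_diff borel_measurable_divide borel_measurable_sum) auto
  qed
  have U_eq: "(\<integral>\<^sup>+\<omega>. ?U \<omega> \<partial>?P) = (\<Sum>i=1..n. \<Sum>k=1..n. \<integral>\<^sup>+\<omega>. (if i = k then 0 else g (\<omega> i, \<omega> k)) \<partial>?P)"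
    using gm by (intro trans[OF nn_integral_sum sum.cong[OF refl nn_integral_sum]] borel_measurable_sum)
  \<comment> \<open>Each off-diagonal pair has expectation exactly \<open>?e\<close>. The zero
    diagonal terms are bounded by \<open>?e\<close> as well, so that n^2 cancels the
    normalization.\<close>
  have "(\<integral>\<^sup>+\<omega>. ?U \<omega> \<partial>?P) \<le> (\<Sum>i=1..n. \<Sum>k=1..n. ?e)"
    unfolding U_eq
  proof (intro sum_mono)
    fix i k assume ik: "i \<in> {1..n}" "k \<in> {1..n}"
    show "(\<integral>\<^sup>+\<omega>. (if i = k then 0 else g (\<omega> i, \<omega> k)) \<partial>?P) \<le> ?e"
    proof (cases "i = k")
      case False
      have "(\<integral>\<^sup>+\<omega>. g (\<omega> i, \<omega> k) \<partial>?P) = (\<integral>\<^sup>+p. g p \<partial>distr ?P (M \<Otimes>\<^sub>M M) (\<lambda>\<omega>. (\<omega> i, \<omega> k)))"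
        using g by (intro nn_integral_distr[OF pair[OF ik], symmetric]) simp
      then show ?thesis unfolding distr_PiM_pair[OF ik False] using False by simp
    qed simp
  qed
  then have "(\<integral>\<^sup>+\<omega>. ?U \<omega> \<partial>?P) \<le> ennreal ((real n)\<^sup>2) * ?e"
  proof -
    have "(\<Sum>i=1..n. \<Sum>k=1..n. ?e) = of_nat n * of_nat n * ?e" by (simp add: mult.assoc)
    moreover have "ennreal ((real n)\<^sup>2) = of_nat n * of_nat n"
      by (simp only: power2_eq_square ennreal_mult[OF of_nat_0_le_iff of_nat_0_le_iff]
          ennreal_of_nat_eq_real_of_nat)
    ultimately show ?thesis
      using \<open>(\<integral>\<^sup>+\<omega>. ?U \<omega> \<partial>?P) \<le> (\<Sum>i=1..n. \<Sum>k=1..n. ?e)\<close> by metis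
  qed
  then have "ennreal (1 / (real n)\<^sup>2) * (\<integral>\<^sup>+\<omega>. ?U \<omega> \<partial>?P) \<le>
      ennreal (1 / (real n)\<^sup>2) * (ennreal ((real n)\<^sup>2) * ?e)"
    by (rule mult_left_mono) simp
  also have "\<dots> = ennreal (1 / (real n)\<^sup>2 * (real n)\<^sup>2) * ?e"
    by (subst ennreal_mult) (auto simp: mult.assoc)
  also have "\<dots> = ?e" using n by simp
  finally have U: "ennreal (1 / (real n)\<^sup>2) * (\<integral>\<^sup>+\<omega>. ?U \<omega> \<partial>?P) \<le> ?e" .
  have "ennreal (sqrt (real n)) * (\<Sum>l<n. ennreal ((1/2) ^ l) * (\<integral>\<^sup>+\<omega>. ?d l \<omega> \<partial>?P)) \<le>
      ennreal (sqrt (real n)) * (\<Sum>l<n. ennreal ((1/2) ^ l) * ennreal (1 / real n))"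
    by (intro mult_left_mono sum_mono PiM_variance_frequency_le n A) auto
  also have "\<dots> = ennreal (sqrt (real n) * ((\<Sum>l<n. (1/2) ^ l) * (1 / real n)))"
  proof -
    have "(\<Sum>l<n. ennreal ((1/2) ^ l) * ennreal (1 / real n)) =
        (\<Sum>l<n. ennreal ((1/2) ^ l)) * ennreal (1 / real n)"
      by (rule sum_distrib_right[symmetric])
    also have "(\<Sum>l<n. ennreal ((1/2) ^ l)) = ennreal (\<Sum>l<n. (1/2) ^ l)"
      by (rule sum_ennreal) simp
    also have "\<dots> * ennreal (1 / real n) = ennreal ((\<Sum>l<n. (1/2) ^ l) * (1 / real n))"
      by (rule ennreal_mult[symmetric]) (auto intro: sum_nonneg)
    also have "ennreal (sqrt (real n)) * \<dots> = ennreal (sqrt (real n) * ((\<Sum>l<n. (1/2) ^ l) * (1 / real n)))"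
      by (rule ennreal_mult[symmetric]) (auto intro!: sum_nonneg divide_nonneg_nonneg)
    finally show ?thesis .
  qed
  \<comment> \<open>The geometric weights sum to at most 2, whatever the number of test
    sets.\<close>
  also have "\<dots> \<le> ennreal (sqrt (real n) * (2 * (1 / real n)))"
    by (intro ennreal_leI mult_left_mono mult_right_mono)
       (auto simp: geometric_sum)
  also have "sqrt (real n) * (2 * (1 / real n)) = 2 / sqrt (real n)"
    using n real_div_sqrt[of "real n"] by (simp add: divide_simps)
  finally have D: "ennreal (sqrt (real n)) * (\<Sum>l<n. ennreal ((1/2) ^ l) * (\<integral>\<^sup>+\<omega>. ?d l \<omega> \<partial>?P))
      \<le> ennreal (2 / sqrt (real n))" .
  \<comment> \<open>Energy and deviations are added into a single random variable, so that one
    sample is good for both at once.\<close>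
  let ?X = "\<lambda>\<omega>. ennreal (1 / (real n)\<^sup>2) * ?U \<omega> +
    ennreal (sqrt (real n)) * (\<Sum>l<n. ennreal ((1/2) ^ l) * ?d l \<omega>)"
  have Um: "?U \<in> borel_measurable ?P" by (intro borel_measurable_sum gm)
  have Dm: "(\<lambda>\<omega>. \<Sum>l<n. ennreal ((1/2) ^ l) * ?d l \<omega>) \<in> borel_measurable ?P"
    by (intro borel_measurable_sum borel_measurable_times_ennreal dm) auto
  have Xm: "?X \<in> borel_measurable ?P"
    by (intro borel_measurable_add borel_measurable_times_ennreal Um Dm) auto
  have "(\<integral>\<^sup>+\<omega>. ?X \<omega> \<partial>?P) = ennreal (1 / (real n)\<^sup>2) * (\<integral>\<^sup>+\<omega>. ?U \<omega> \<partial>?P) +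
      ennreal (sqrt (real n)) * (\<Sum>l<n. ennreal ((1/2) ^ l) * (\<integral>\<^sup>+\<omega>. ?d l \<omega> \<partial>?P))"
  proof -
    have "(\<integral>\<^sup>+\<omega>. ?X \<omega> \<partial>?P) = (\<integral>\<^sup>+\<omega>. ennreal (1 / (real n)\<^sup>2) * ?U \<omega> \<partial>?P) +
        (\<integral>\<^sup>+\<omega>. ennreal (sqrt (real n)) * (\<Sum>l<n. ennreal ((1/2) ^ l) * ?d l \<omega>) \<partial>?P)"
      by (rule nn_integral_add[OF borel_measurable_times_ennreal[OF borel_measurable_const Um]
            borel_measurable_times_ennreal[OF borel_measurable_const Dm]])
    moreover have "(\<integral>\<^sup>+\<omega>. ennreal (1 / (real n)\<^sup>2) * ?U \<omega> \<partial>?P) =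
        ennreal (1 / (real n)\<^sup>2) * (\<integral>\<^sup>+\<omega>. ?U \<omega> \<partial>?P)"
      by (rule nn_integral_cmult[OF Um])
    moreover have "(\<integral>\<^sup>+\<omega>. ennreal (sqrt (real n)) * (\<Sum>l<n. ennreal ((1/2) ^ l) * ?d l \<omega>) \<partial>?P) =
        ennreal (sqrt (real n)) * (\<integral>\<^sup>+\<omega>. (\<Sum>l<n. ennreal ((1/2) ^ l) * ?d l \<omega>) \<partial>?P)"
      by (rule nn_integral_cmult[OF Dm])
    moreover have "(\<integral>\<^sup>+\<omega>. (\<Sum>l<n. ennreal ((1/2) ^ l) * ?d l \<omega>) \<partial>?P) =
        (\<Sum>l<n. ennreal ((1/2) ^ l) * (\<integral>\<^sup>+\<omega>. ?d l \<omega> \<partial>?P))"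
      by (intro trans[OF nn_integral_sum sum.cong[OF refl nn_integral_cmult]]
          borel_measurable_times_ennreal borel_measurable_const dm)
    ultimately show ?thesis by (simp only:)
  qed
  also have "\<dots> \<le> ?e + ennreal (2 / sqrt (real n))" by (rule add_mono[OF U D])
  finally obtain \<omega> where \<omega>: "\<omega> \<in> space ?P" "?X \<omega> \<le> ?e + ennreal (2 / sqrt (real n))"
    using P.exists_le_nn_integral[OF Xm] by blast
  show thesis
    by (rule that[OF _ \<omega>(2)]) (use \<omega>(1) in \<open>auto simp: space_PiM PiE_iff\<close>)
qed

text \<open>Taking differences of finite unions makes the pieces of the step function disjoint; hence
  the countably many finite unions of basis sets suffice to test weak convergence.\<close>

lemma C0_approx_by_finite_unions:
  fixes F :: "'a::euclidean_space set"
  assumes F: "closed F" and f: "f \<in> C0 F" and \<B>: "topological_basis \<B>" and e: "e > 0"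
  obtains m :: nat and c :: "nat \<Rightarrow> real" and B :: "nat \<Rightarrow> 'a set"
  where "\<And>i. i < m \<Longrightarrow> B i \<in> \<B>"
    "\<And>x. x \<in> F \<Longrightarrow>
      \<bar>f x - (\<Sum>i<m. c i * (indicator (\<Union>l<Suc i. B l) x - indicator (\<Union>l<i. B l) x))\<bar> \<le> e"
proof -
  obtain b where b: "\<And>x. x \<in> F \<Longrightarrow> b \<le> norm x \<Longrightarrow> \<bar>f x\<bar> < e"
    using f e unfolding C0_iff by blast
  let ?K = "F \<inter> cball 0 b"
  have K: "compact ?K" using F by (simp add: closed_Int_compact)
  have "\<exists>U\<in>\<B>. x \<in> U \<and> (\<forall>y\<in>U \<inter> F. \<bar>f y - f x\<bar> < e)" if x: "x \<in> ?K" for x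
  proof -
    have "continuous_on F f" using f by (simp add: C0_iff)
    then obtain \<rho> where \<rho>: "\<rho> > 0" "\<And>y. y \<in> F \<Longrightarrow> dist y x < \<rho> \<Longrightarrow> dist (f y) (f x) < e"
      using x e unfolding continuous_on_iff by blast
    obtain U where "U \<in> \<B>" "x \<in> U" "U \<subseteq> ball x \<rho>"
      using topological_basisE[OF \<B> open_ball, of x x \<rho>] \<rho>(1) by auto
    then show ?thesis
      using \<rho>(2) by (intro bexI[of _ U]) (auto simp: dist_real_def dist_commute)
  qed
  then obtain U where U: "\<And>x. x \<in> ?K \<Longrightarrow> U x \<in> \<B>" "\<And>x. x \<in> ?K \<Longrightarrow> x \<in> U x"
    "\<And>x y. x \<in> ?K \<Longrightarrow> y \<in> U x \<Longrightarrow> y \<in> F \<Longrightarrow> \<bar>f y - f x\<bar> < e" by (metis IntI)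
  have "\<And>x. x \<in> ?K \<Longrightarrow> open (U x)" using U(1) topological_basis_open[OF \<B>] by blast
  then obtain S where S: "S \<subseteq> ?K" "finite S" "?K \<subseteq> (\<Union>x\<in>S. U x)"
    using U(2) by (elim compactE_image[OF K, of ?K U]) auto
  obtain p and m :: nat where p: "S = p ` {..<m}"
    using S(2) by (metis finite_imp_nat_seg_image_inj_on lessThan_def)
  have pK: "p i \<in> ?K" if "i < m" for i using S(1) p that by auto
  show thesis
  proof (rule that[of m "\<lambda>i. U (p i)" "\<lambda>i. f (p i)"])
    show "U (p i) \<in> \<B>" if "i < m" for i using U(1)[OF pK[OF that]] .
    fix x assume x: "x \<in> F"
    let ?B = "\<lambda>i. U (p i)"
    let ?t = "\<lambda>i. f (p i) * (indicator (\<Union>l<Suc i. ?B l) x - indicator (\<Union>l<i. ?B l) x)"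
    show "\<bar>f x - (\<Sum>i<m. ?t i)\<bar> \<le> e"
    proof (cases "\<exists>i<m. x \<in> ?B i")
      case True
      \<comment> \<open>The unions increase with i and x enters them exactly at step k, so all other
        differences of indicators vanish at x.\<close>
      define k where "k = (LEAST i. i < m \<and> x \<in> ?B i)"
      have k: "k < m" "x \<in> ?B k" using LeastI_ex[OF True] by (auto simp: k_def)
      have least: "x \<notin> ?B i" if "i < k" for i
        using not_less_Least[of i "\<lambda>i. i < m \<and> x \<in> ?B i"] that k(1) by (auto simp: k_def)
      have "?t i = (if i = k then f (p k) else 0)" if "i < m" for i
      proof (cases i k rule: linorder_cases)
        case less
        then show ?thesis using least by (auto simp: indicator_def less_Suc_eq)
      next
        case equal
        then show ?thesis using least k by (auto simp: indicator_def)
      next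
        case greater
        then show ?thesis using k by (auto simp: indicator_def intro: less_SucI)
      qed
      then have "(\<Sum>i<m. ?t i) = (\<Sum>i<m. if i = k then f (p k) else 0)"
        by (intro sum.cong) auto
      also have "\<dots> = f (p k)" using k(1) by simp
      finally show ?thesis using U(3)[OF pK[OF k(1)] k(2) x] by simp
    next
      \<comment> \<open>Outside all pieces the step function is 0 and x lies outside the ball beyond
        which f is smaller than e.\<close>
      case False
      then have "x \<notin> ?K" using S(3) p by auto
      then have "\<bar>f x\<bar> < e" using b x by auto
      moreover have "(\<Sum>i<m. ?t i) = 0"
        using False by (intro sum.neutral) (auto simp: indicator_def less_Suc_eq)
      ultimately show ?thesis by simp
    qed
  qed
qed

text \<open>Averages and the integral change by at most e when f is replaced by its step function,
  and the averages of the step function converge as finite combinations of frequencies.\<close>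

lemma sampled_averages_tendsto:
  fixes F :: "'a::euclidean_space set" and x :: "nat \<Rightarrow> nat \<Rightarrow> 'a"
  assumes F: "closed F" and \<nu>: "\<nu> \<in> radon_measures_pos F" "prob_space \<nu>"
    and \<B>: "topological_basis \<B>" and x: "\<And>n. x n ` {1..n} \<subseteq> F"
    and lim: "\<And>S. finite S \<Longrightarrow> S \<subseteq> \<B> \<Longrightarrow>
      (\<lambda>n. (\<Sum>i=1..n. indicator (\<Union>S) (x n i)) / real n) \<longlonglongrightarrow> measure \<nu> (\<Union>S \<inter> F)"
    and f: "f \<in> C0 F"
  shows "(\<lambda>n. (\<Sum>i=1..n. f (x n i)) / real n) \<longlonglongrightarrow> (\<integral>y. f y \<partial>\<nu>)"
proof (rule tendstoI)
  fix e0 :: real assume "e0 > 0"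
  \<comment> \<open>Three errors of size e occur: two from the step function and one from the
    convergence of its averages.\<close>
  define e where "e = e0 / 4"
  have e: "e > 0" "3 * e < e0" using \<open>e0 > 0\<close> by (auto simp: e_def)
  interpret prob_space \<nu> by (rule \<nu>(2))
  obtain m :: nat and c :: "nat \<Rightarrow> real" and B :: "nat \<Rightarrow> 'a set"
    where B: "\<And>i. i < m \<Longrightarrow> B i \<in> \<B>" and
      app: "\<And>x. x \<in> F \<Longrightarrow>
      \<bar>f x - (\<Sum>i<m. c i * (indicator (\<Union>l<Suc i. B l) x - indicator (\<Union>l<i. B l) x))\<bar> \<le> e"
    by (rule C0_approx_by_finite_unions[OF F f \<B> e(1)]) blast
  let ?U = "\<lambda>i. \<Union>l<i. B l"
  define h where "h x = (\<Sum>i<m. c i * (indicator (?U (Suc i)) x - indicator (?U i) x))" for x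
  have U: "open (?U i)" if "i \<le> m" for i
    using that B topological_basis_open[OF \<B>] by auto
  have U_sets: "?U i \<inter> F \<in> sets \<nu>" if "i \<le> m" for i
    using U[OF that] by (auto simp: sets_radon[OF \<nu>(1)] sets_restrict_space intro!: image_eqI[of _ _ "?U i"])
  have int_U: "(\<integral>y. indicator (?U i) y \<partial>\<nu>) = measure \<nu> (?U i \<inter> F)"
    and ible_U: "integrable \<nu> (\<lambda>y. indicator (?U i) y :: real)" if "i \<le> m" for i
  proof -
    \<comment> \<open>The space of \<nu> is F, so it is the trace on F of an open set that is known
      to be measurable; the indicators agree on F.\<close>
    have eq: "indicator (?U i) y = (indicator (?U i \<inter> F) y :: real)" if "y \<in> space \<nu>" for y
      using that by (auto simp: indicator_def space_radon[OF \<nu>(1)])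
    show "(\<integral>y. indicator (?U i) y \<partial>\<nu>) = measure \<nu> (?U i \<inter> F)"
      using U_sets[OF that] by (subst Bochner_Integration.integral_cong[OF refl eq]) auto
    show "integrable \<nu> (\<lambda>y. indicator (?U i) y :: real)"
      using U_sets[OF that] by (subst Bochner_Integration.integrable_cong[OF refl eq])
        (auto simp: emeasure_eq_measure)
  qed
  have swap: "(\<Sum>k<m. c k * ((\<Sum>i=1..n. u (Suc k) (x n i)) / real n - (\<Sum>i=1..n. u k (x n i)) / real n)) =
      (\<Sum>i=1..n. \<Sum>k<m. c k * (u (Suc k) (x n i) - u k (x n i))) / real n"
    for n and u :: "nat \<Rightarrow> 'a \<Rightarrow> real"
    by (subst sum.swap) (simp add: sum_divide_distrib sum_distrib_left sum_subtractf diff_divide_distrib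
        right_diff_distrib)
  have ible_h: "integrable \<nu> h"
    unfolding h_def using ible_U by (intro Bochner_Integration.integrable_sum) auto
  have "(\<integral>y. h y \<partial>\<nu>) = (\<Sum>i<m. c i * (measure \<nu> (?U (Suc i) \<inter> F) - measure \<nu> (?U i \<inter> F)))"
    unfolding h_def using ible_U int_U
    by (subst Bochner_Integration.integral_sum) (auto intro!: sum.cong simp del: UN_simps lessThan_Suc)
  moreover have "(\<lambda>n. (\<Sum>i=1..n. indicator (?U k) (x n i)) / real n) \<longlonglongrightarrow> measure \<nu> (?U k \<inter> F)"
    if "k \<le> m" for k
    using lim[of "B ` {..<k}"] B that by (simp add: image_subset_iff)
  then have "(\<lambda>n. \<Sum>k<m. c k * ((\<Sum>i=1..n. indicator (?U (Suc k)) (x n i)) / real n -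
      (\<Sum>i=1..n. indicator (?U k) (x n i)) / real n))
      \<longlonglongrightarrow> (\<Sum>k<m. c k * (measure \<nu> (?U (Suc k) \<inter> F) - measure \<nu> (?U k \<inter> F)))"
    by (intro tendsto_sum tendsto_mult tendsto_diff tendsto_const) auto
  moreover have "(\<Sum>k<m. c k * ((\<Sum>i=1..n. indicator (?U (Suc k)) (x n i)) / real n -
      (\<Sum>i=1..n. indicator (?U k) (x n i)) / real n)) = (\<Sum>i=1..n. h (x n i)) / real n" for n
    unfolding h_def by (rule swap)
  ultimately have lim_h: "(\<lambda>n. (\<Sum>i=1..n. h (x n i)) / real n) \<longlonglongrightarrow> (\<integral>y. h y \<partial>\<nu>)" by simp
  have fh: "\<bar>f y - h y\<bar> \<le> e" if "y \<in> F" for y using app[OF that] by (simp add: h_def)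
  have "\<bar>(\<integral>y. f y \<partial>\<nu>) - (\<integral>y. h y \<partial>\<nu>)\<bar> = \<bar>\<integral>y. f y - h y \<partial>\<nu>\<bar>"
    using integrable_C0[OF F f \<nu>(1)] ible_h by simp
  also have "\<dots> \<le> (\<integral>y. \<bar>f y - h y\<bar> \<partial>\<nu>)" by (rule integral_abs_bound)
  also have "\<dots> \<le> (\<integral>y. e \<partial>\<nu>)"
    using integrable_C0[OF F f \<nu>(1)] ible_h fh by (intro integral_mono) (auto simp: space_radon[OF \<nu>(1)])
  also have "\<dots> = e" by (simp add: prob_space)
  finally have 1: "\<bar>(\<integral>y. f y \<partial>\<nu>) - (\<integral>y. h y \<partial>\<nu>)\<bar> \<le> e" .
  have 2: "\<bar>(\<Sum>i=1..n. f (x n i)) / real n - (\<Sum>i=1..n. h (x n i)) / real n\<bar> \<le> e" for n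
  proof (cases "n = 0")
    case False
    have "\<bar>(\<Sum>i=1..n. f (x n i)) - (\<Sum>i=1..n. h (x n i))\<bar> \<le> (\<Sum>i=1..n. \<bar>f (x n i) - h (x n i)\<bar>)"
      unfolding sum_subtractf[symmetric] by (rule sum_abs)
    also have "\<dots> \<le> (\<Sum>i=1..n. e)" using x by (intro sum_mono fh) blast
    finally show ?thesis using False by (simp add: field_simps flip: diff_divide_distrib)
  qed (use e in simp)
  show "\<forall>\<^sub>F n in sequentially. dist ((\<Sum>i=1..n. f (x n i)) / real n) (\<integral>y. f y \<partial>\<nu>) < e0"
    using tendstoD[OF lim_h e(1)]
  proof eventually_elim
    case (elim n)
    then show ?case using 1 2[of n] e(2) unfolding dist_real_def by linarith
  qed
qed

text \<open>The points for each n are chosen afresh, as a triangular array: the points for n + 1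
  need not extend those for n. The limits follow from the quantitative bound at each n.\<close>

lemma exists_sampling_sequence:
  fixes F :: "'a::euclidean_space set"
  assumes F: "closed F" and \<nu>: "\<nu> \<in> radon_measures_pos F" "prob_space \<nu>"
    and e: "(\<integral>\<^sup>+p. coulomb (fst p) (snd p) \<partial>(\<nu> \<Otimes>\<^sub>M \<nu>)) \<le> ennreal e" "e \<ge> 0"
  obtains x :: "nat \<Rightarrow> nat \<Rightarrow> 'a" where
    "\<And>n. x n ` {1..n} \<subseteq> F" "\<And>n. inj_on (x n) {1..n}"
    "\<And>n. (\<Sum>i=1..n. \<Sum>k=1..n. 1 / norm (x n i - x n k)) / (real n)\<^sup>2 \<le> e + 2 / sqrt (real n)"
    "\<And>f. f \<in> C0 F \<Longrightarrow> (\<lambda>n. (\<Sum>i=1..n. f (x n i)) / real n) \<longlonglongrightarrow> (\<integral>y. f y \<partial>\<nu>)"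
proof -
  interpret prob_space \<nu> by (rule \<nu>(2))
  obtain \<B> :: "'a set set" where \<B>: "countable \<B>" "topological_basis \<B>"
    using ex_countable_basis by blast
  let ?\<U> = "Union ` {S. finite S \<and> S \<subseteq> \<B>}"
  have "countable ?\<U>"
    by (intro countable_image countable_Collect_finite_subset \<B>(1))
  moreover have "?\<U> \<noteq> {}" by blast
  ultimately obtain A :: "nat \<Rightarrow> 'a set" where A: "?\<U> = range A"
    using range_from_nat_into by metis
  have A_open: "open (A l)" for l
  proof -
    have "A l \<in> ?\<U>" using A by blast
    then obtain S where "A l = \<Union>S" "S \<subseteq> \<B>" by blast
    then show ?thesis using topological_basis_open[OF \<B>(2)] by (metis open_Union subsetD)
  qed
  have AF: "A l \<inter> F \<in> events" for l
    using A_open by (auto simp: sets_radon[OF \<nu>(1)] sets_restrict_space intro!: image_eqI[of _ _ "A l"])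
  let ?g = "\<lambda>p::'a \<times> 'a. coulomb (fst p) (snd p)"
  have g: "?g \<in> borel_measurable (\<nu> \<Otimes>\<^sub>M \<nu>)" by (rule measurable_pair_radon[OF \<nu>(1)]) measurable
  define good where "good n x \<longleftrightarrow> x ` {1..n} \<subseteq> F \<and>
    ennreal (1 / (real n)\<^sup>2) * (\<Sum>i=1..n. \<Sum>k=1..n. if i = k then 0 else coulomb (x i) (x k)) +
     ennreal (sqrt (real n)) * (\<Sum>l<n. ennreal ((1/2) ^ l) *
       ennreal (((\<Sum>i=1..n. indicator (A l \<inter> F) (x i)) / real n - prob (A l \<inter> F))\<^sup>2))
     \<le> ennreal (e + 2 / sqrt (real n))" for n and x :: "nat \<Rightarrow> 'a"
  have "\<exists>x. good n x" for n
  proof (cases "n = 0")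
    case False
    then have "n \<ge> 1" by simp
    from exists_good_sample[OF g, of "\<lambda>l. A l \<inter> F", OF AF this]
    obtain x where x: "x ` {1..n} \<subseteq> space \<nu>"
      "ennreal (1 / (real n)\<^sup>2) * (\<Sum>i=1..n. \<Sum>k=1..n. if i = k then 0 else ?g (x i, x k)) +
     ennreal (sqrt (real n)) * (\<Sum>l<n. ennreal ((1/2) ^ l) *
       ennreal (((\<Sum>i=1..n. indicator (A l \<inter> F) (x i)) / real n - prob (A l \<inter> F))\<^sup>2))
     \<le> (\<integral>\<^sup>+p. ?g p \<partial>(\<nu> \<Otimes>\<^sub>M \<nu>)) + ennreal (2 / sqrt (real n))" by blast
    note x(2)
    also have "(\<integral>\<^sup>+p. ?g p \<partial>(\<nu> \<Otimes>\<^sub>M \<nu>)) + ennreal (2 / sqrt (real n)) \<le> ennreal e + ennreal (2 / sqrt (real n))"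
      by (intro add_right_mono e)
    also have "\<dots> = ennreal (e + 2 / sqrt (real n))" using e(2) by simp
    finally have "good n x"
      using x(1) unfolding good_def space_radon[OF \<nu>(1)] fst_conv snd_conv by (intro conjI)
    then show ?thesis by blast
  qed (simp add: good_def)
  then obtain x where x: "\<And>n. good n (x n)" by metis
  have xF: "x n ` {1..n} \<subseteq> F" for n using x by (simp add: good_def)
  have add_le_D: "a \<le> c" "b \<le> c" if "a + b \<le> c" for a b c :: ennreal
    using that by (auto intro: order_trans[OF _ that])
  have energy: "ennreal (1 / (real n)\<^sup>2) * (\<Sum>i=1..n. \<Sum>k=1..n. if i = k then 0 else coulomb (x n i) (x n k))
      \<le> ennreal (e + 2 / sqrt (real n))" for n
    by (rule add_le_D(1)[OF conjunct2[OF x[of n, unfolded good_def]]])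
  \<comment> \<open>Coincident points with different indices would put the diagonal value infinity
    into the energy sum, whose weight 1/n^2 is positive.\<close>
  have inj: "inj_on (x n) {1..n}" for n
  proof (rule inj_onI, rule ccontr)
    fix i k assume ik: "i \<in> {1..n}" "k \<in> {1..n}" "x n i = x n k" "i \<noteq> k"
    have "(\<infinity>::ennreal) = (if i = k then 0 else coulomb (x n i) (x n k))"
      using ik by (simp add: coulomb_diag)
    also have "\<dots> \<le> (\<Sum>k=1..n. if i = k then 0 else coulomb (x n i) (x n k))"
      using ik by (intro member_le_sum) auto
    also have "\<dots> \<le> (\<Sum>i=1..n. \<Sum>k=1..n. if i = k then 0 else coulomb (x n i) (x n k))"
      using ik by (intro member_le_sum[of i _ "\<lambda>i. \<Sum>k=1..n. if i = k then 0 else coulomb (x n i) (x n k)"]) auto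
    finally have inf: "(\<Sum>i=1..n. \<Sum>k=1..n. if i = k then 0 else coulomb (x n i) (x n k)) = \<infinity>"
      by (simp add: top_unique)
    show False
      using energy[of n] ik(1) unfolding inf by (simp add: ennreal_mult_top top_unique)
  qed
  have en: "(\<Sum>i=1..n. \<Sum>k=1..n. 1 / norm (x n i - x n k)) / (real n)\<^sup>2 \<le> e + 2 / sqrt (real n)" for n
  proof -
    have "(\<Sum>i=1..n. \<Sum>k=1..n. if i = k then 0 else coulomb (x n i) (x n k)) =
        (\<Sum>i=1..n. \<Sum>k=1..n. ennreal (1 / norm (x n i - x n k)))"
      using inj[of n] by (intro sum.cong refl) (auto simp: coulomb_eq inj_on_eq_iff)
    also have "\<dots> = ennreal (\<Sum>i=1..n. \<Sum>k=1..n. 1 / norm (x n i - x n k))"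
      by (simp add: sum_ennreal sum_nonneg)
    finally have eq: "(\<Sum>i=1..n. \<Sum>k=1..n. if i = k then 0 else coulomb (x n i) (x n k)) =
        ennreal (\<Sum>i=1..n. \<Sum>k=1..n. 1 / norm (x n i - x n k))" .
    have "ennreal (1 / (real n)\<^sup>2 * (\<Sum>i=1..n. \<Sum>k=1..n. 1 / norm (x n i - x n k))) =
        ennreal (1 / (real n)\<^sup>2) * ennreal (\<Sum>i=1..n. \<Sum>k=1..n. 1 / norm (x n i - x n k))"
      by (rule ennreal_mult) (auto intro!: sum_nonneg)
    also have "\<dots> \<le> ennreal (e + 2 / sqrt (real n))"
      using energy[of n] unfolding eq .
    finally have "1 / (real n)\<^sup>2 * (\<Sum>i=1..n. \<Sum>k=1..n. 1 / norm (x n i - x n k)) \<le> e + 2 / sqrt (real n)"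
      using e(2) by (subst (asm) ennreal_le_iff) auto
    then show ?thesis by simp
  qed
  have freq: "(\<lambda>n. (\<Sum>i=1..n. indicator (A l \<inter> F) (x n i)) / real n) \<longlonglongrightarrow> prob (A l \<inter> F)" for l
  proof -
    define d where "d l n = (\<Sum>i=1..n. indicator (A l \<inter> F) (x n i)) / real n - prob (A l \<inter> F)" for l n
    have "(\<lambda>n. (d l n)\<^sup>2) \<longlonglongrightarrow> 0"
    proof (rule tendsto_sandwich[OF _ _ tendsto_const])
      \<comment> \<open>Stage n controls only the first n test sets, so a fixed l is covered as soon
        as n > l. Its single term, with weight \<open>sqrt n * (1/2) ^ l\<close>, is then at most e
        + 2.\<close>
      show "\<forall>\<^sub>F n in sequentially. (d l n)\<^sup>2 \<le> (e + 2) * 2 ^ l / sqrt (real n)"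
        using eventually_gt_at_top[of l]
      proof eventually_elim
        fix n assume n: "l < n"
        have "ennreal (sqrt (real n) * ((1/2) ^ l * (d l n)\<^sup>2)) =
            ennreal (sqrt (real n)) * (ennreal ((1/2) ^ l) * ennreal ((d l n)\<^sup>2))"
          by (simp only: ennreal_mult[symmetric] zero_le_power2 zero_le_power divide_nonneg_nonneg
              zero_le_one zero_le_numeral mult_nonneg_nonneg real_sqrt_ge_zero of_nat_0_le_iff)
        also have "\<dots> \<le> ennreal (sqrt (real n)) * (\<Sum>l<n. ennreal ((1/2) ^ l) * ennreal ((d l n)\<^sup>2))"
          using n by (intro mult_left_mono member_le_sum) auto
        also have "\<dots> \<le> ennreal (e + 2 / sqrt (real n))"
          by (rule add_le_D(2)[OF conjunct2[OF x[of n, unfolded good_def, folded d_def]]])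
        finally have "sqrt (real n) * ((1/2) ^ l * (d l n)\<^sup>2) \<le> e + 2 / sqrt (real n)"
          using e(2) by (subst (asm) ennreal_le_iff) auto
        also have "\<dots> \<le> e + 2" using n by (simp add: divide_le_eq)
        finally have "sqrt (real n) * ((1/2) ^ l * (d l n)\<^sup>2) \<le> e + 2" .
        moreover have "sqrt (real n) > 0" using n by simp
        ultimately show "(d l n)\<^sup>2 \<le> (e + 2) * 2 ^ l / sqrt (real n)"
          by (simp add: power_one_over field_simps)
      qed
      show "(\<lambda>n. (e + 2) * 2 ^ l / sqrt (real n)) \<longlonglongrightarrow> 0"
        by (intro real_tendsto_divide_at_top[OF tendsto_const]
            filterlim_compose[OF sqrt_at_top filterlim_real_sequentially])
      show "\<forall>\<^sub>F n in sequentially. 0 \<le> (d l n)\<^sup>2" by simp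
    qed
    from tendsto_real_sqrt[OF this] have "d l \<longlonglongrightarrow> 0"
      by (simp add: tendsto_rabs_zero_iff)
    then show ?thesis unfolding d_def by (rule LIM_zero_cancel)
  qed
  have avg: "(\<lambda>n. (\<Sum>i=1..n. f (x n i)) / real n) \<longlonglongrightarrow> (\<integral>y. f y \<partial>\<nu>)" if f: "f \<in> C0 F" for f
  proof -
    have "(\<lambda>n. (\<Sum>i=1..n. indicator (\<Union>S) (x n i)) / real n) \<longlonglongrightarrow> measure \<nu> (\<Union>S \<inter> F)"
      if S: "finite S" "S \<subseteq> \<B>" for S
    proof -
      have "\<Union>S \<in> range A" unfolding A[symmetric] using S by (intro imageI CollectI conjI)
      then obtain l where l: "\<Union>S = A l" by (rule rangeE)
      have "indicator (A l) (x n i) = (indicator (A l \<inter> F) (x n i) :: real)" if "i \<in> {1..n}" for n i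
        using xF[of n] that by (auto simp: indicator_def image_subset_iff)
      then have "(\<Sum>i=1..n. indicator (A l) (x n i)) = (\<Sum>i=1..n. indicator (A l \<inter> F) (x n i) :: real)" for n
        by (intro sum.cong) auto
      then show ?thesis using freq[of l] unfolding l by presburger
    qed
    from sampled_averages_tendsto[of F \<nu> \<B> x, OF F \<nu> \<B>(2) xF this f] show ?thesis .
  qed
  show thesis by (rule that[of x, OF xF inj en avg])
qed

section \<open>Recovery sequences\<close>

text \<open>Inner regularity survives normalization because a constant factor commutes with the
  supremum over compact sets.\<close>

lemma radon_density_const:
  assumes \<mu>: "\<mu> \<in> radon_measures_pos F"
  shows "density \<mu> (\<lambda>_. ennreal c) \<in> radon_measures_pos F"
proof -
  have em: "emeasure (density \<mu> (\<lambda>_. ennreal c)) A = ennreal c * emeasure \<mu> A" if "A \<in> sets \<mu>" for A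
    using that by (simp add: emeasure_density nn_integral_cmult_indicator)
  interpret finite_measure \<mu> using finite_measure_radon[OF \<mu>] .
  show ?thesis
    unfolding radon_measures_pos_def
  proof (intro CollectI conjI ballI)
    show "sets (density \<mu> (\<lambda>_. ennreal c)) = sets (restrict_space borel F)"
      using sets_radon[OF \<mu>] by simp
    show "finite_measure (density \<mu> (\<lambda>_. ennreal c))"
      by (intro finite_measureI) (simp add: em ennreal_mult_eq_top_iff emeasure_eq_measure)
    fix A assume A: "A \<in> sets (density \<mu> (\<lambda>_. ennreal c))"
    have F: "\<And>K. compact K \<Longrightarrow> K \<subseteq> A \<Longrightarrow> K \<in> sets \<mu>"
    proof -
      fix K assume K: "compact K" "K \<subseteq> A"
      have "A \<subseteq> F" using A sets.sets_into_space[of A \<mu>] space_radon[OF \<mu>] by auto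
      then show "K \<in> sets \<mu>"
        using K unfolding sets_radon[OF \<mu>] sets_restrict_space
        by (intro image_eqI[of _ _ K]) (auto intro: borel_compact)
    qed
    have "emeasure \<mu> A = (SUP K\<in>{K. compact K \<and> K \<subseteq> A}. emeasure \<mu> K)"
      using A \<mu> by (simp add: radon_measures_pos_def)
    then show "emeasure (density \<mu> (\<lambda>_. ennreal c)) A =
        (SUP K\<in>{K. compact K \<and> K \<subseteq> A}. emeasure (density \<mu> (\<lambda>_. ennreal c)) K)"
      using A F by (simp add: em SUP_mult_left_ennreal)
  qed
qed

lemma nn_integral_pair_density_const:
  assumes "finite_measure \<mu>" and g: "g \<in> borel_measurable (\<mu> \<Otimes>\<^sub>M \<mu>)" and c: "c \<ge> 0"
  shows "(\<integral>\<^sup>+p. g p \<partial>(density \<mu> (\<lambda>_. ennreal c) \<Otimes>\<^sub>M density \<mu> (\<lambda>_. ennreal c))) =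
    ennreal (c\<^sup>2) * (\<integral>\<^sup>+p. g p \<partial>(\<mu> \<Otimes>\<^sub>M \<mu>))"
proof -
  interpret finite_measure \<mu> by fact
  let ?\<nu> = "density \<mu> (\<lambda>_. ennreal c)"
  have "emeasure ?\<nu> (space ?\<nu>) \<noteq> \<infinity>"
    by (simp add: emeasure_density ennreal_mult_eq_top_iff)
  then interpret \<nu>: finite_measure ?\<nu> by (intro finite_measureI)
  have s: "sets (?\<nu> \<Otimes>\<^sub>M ?\<nu>) = sets (\<mu> \<Otimes>\<^sub>M \<mu>)" by (intro sets_pair_measure_cong) auto
  have g': "g \<in> borel_measurable (?\<nu> \<Otimes>\<^sub>M ?\<nu>)"
    using g measurable_cong_sets[OF s refl] by blast
  have g1: "(\<lambda>y. g (x, y)) \<in> borel_measurable \<mu>" if "x \<in> space \<mu>" for x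
    by (rule measurable_compose[OF measurable_Pair1'[OF that] g])
  have g2: "(\<lambda>x. \<integral>\<^sup>+y. g (x, y) \<partial>\<mu>) \<in> borel_measurable \<mu>"
    by (rule borel_measurable_nn_integral_fst[OF g])
  have "(\<integral>\<^sup>+p. g p \<partial>(?\<nu> \<Otimes>\<^sub>M ?\<nu>)) = (\<integral>\<^sup>+x. \<integral>\<^sup>+y. g (x, y) \<partial>?\<nu> \<partial>?\<nu>)"
    by (rule \<nu>.nn_integral_fst[OF g', symmetric])
  also have "\<dots> = (\<integral>\<^sup>+x. ennreal c * (\<integral>\<^sup>+y. g (x, y) \<partial>\<mu>) \<partial>?\<nu>)"
    by (intro nn_integral_cong) (simp add: nn_integral_density nn_integral_cmult g1)
  also have "\<dots> = ennreal c * (\<integral>\<^sup>+x. ennreal c * (\<integral>\<^sup>+y. g (x, y) \<partial>\<mu>) \<partial>\<mu>)"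
    using g2 by (subst nn_integral_density) (auto simp: nn_integral_cmult)
  also have "\<dots> = ennreal c * (ennreal c * (\<integral>\<^sup>+x. \<integral>\<^sup>+y. g (x, y) \<partial>\<mu> \<partial>\<mu>))"
    using g2 by (simp add: nn_integral_cmult)
  also have "\<dots> = ennreal (c\<^sup>2) * (\<integral>\<^sup>+p. g p \<partial>(\<mu> \<Otimes>\<^sub>M \<mu>))"
    using c by (simp add: nn_integral_fst[OF g] power2_eq_square ennreal_mult mult.assoc)
  finally show ?thesis .
qed

text \<open>The new points lie on a ray at radii B + iL, where B exceeds the norms of the old
  points. Every pair of distinct indices that involves a new point then has distance at least L and
  adds at most 1/L.\<close>

lemma extend_by_distant_points:
  fixes F :: "'a::euclidean_space set" and y :: "nat \<Rightarrow> 'a"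
  assumes F: "{x. norm x \<ge> \<rho>} \<subseteq> F" and y: "y ` {1..n} \<subseteq> F" "inj_on y {1..n}"
    and n: "n \<le> N" and L: "L > 0"
  obtains x where "x ` {1..N} \<subseteq> F" "inj_on x {1..N}" "\<And>i. i \<le> n \<Longrightarrow> x i = y i"
    "\<And>i. i > n \<Longrightarrow> norm (x i) \<ge> L"
    "(\<Sum>i=1..N. \<Sum>k=1..N. 1 / norm (x i - x k)) \<le>
     (\<Sum>i=1..n. \<Sum>k=1..n. 1 / norm (y i - y k)) + (real N)\<^sup>2 / L"
proof -
  obtain b :: 'a where b: "norm b = 1"
    using SOME_Basis norm_Basis by blast
  \<comment> \<open>The sum dominates each single norm; the absolute value keeps B nonnegative when
    \<rho> is negative.\<close>
  define B where "B = \<bar>\<rho>\<bar> + (\<Sum>i=1..n. norm (y i))"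
  have B0: "B \<ge> \<bar>\<rho>\<bar>" by (simp add: B_def sum_nonneg)
  have By: "norm (y i) \<le> B" if "i \<in> {1..n}" for i
    using member_le_sum[of i "{1..n}" "\<lambda>i. norm (y i)"] that by (simp add: B_def)
  define x where "x i = (if i \<le> n then y i else (B + real i * L) *\<^sub>R b)" for i
  have far: "norm (x i) = B + real i * L" if "i > n" for i
    using that b B0 L by (simp add: x_def)
  have L_le: "L \<le> real i * L" if "i > n" for i
    using that L by simp
  have xF: "x i \<in> F" if "i \<in> {1..N}" for i
  proof (cases "i \<le> n")
    case True
    then show ?thesis using y that by (auto simp: x_def)
  next
    case False
    then have "norm (x i) \<ge> \<rho>" using far[of i] L_le[of i] B0 L by linarith
    then show ?thesis using F by blast
  qed
  \<comment> \<open>The condition k \<ge> 1 matters: B controls y only on {1..n}, and y 0 is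
    arbitrary.\<close>
  have dist: "norm (x i - x k) \<ge> L" if "i > n" "k \<ge> 1" "i \<noteq> k" for i k
  proof (cases "k \<le> n")
    case True
    then have "norm (x k) \<le> B" using By[of k] that by (simp add: x_def)
    then show ?thesis
      using norm_triangle_ineq2[of "x i" "x k"] far[OF that(1)] L_le[OF that(1)] by linarith
  next
    case False
    then have "x i - x k = ((real i - real k) * L) *\<^sub>R b"
      using that by (simp add: x_def algebra_simps)
    then have "norm (x i - x k) = \<bar>real i - real k\<bar> * L" using b L by (simp add: abs_mult)
    moreover have "\<bar>real i - real k\<bar> \<ge> 1" using that(3) by linarith
    ultimately show ?thesis using L by (simp add: mult_le_cancel_right1)
  qed
  have dist': "norm (x i - x k) \<ge> L" if "i \<ge> 1" "k \<ge> 1" "i \<noteq> k" "i > n \<or> k > n" for i k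
    using dist[of i k] dist[of k i] that by (metis norm_minus_commute)
  show thesis
  proof (rule that[of x])
    show "x ` {1..N} \<subseteq> F" using xF by auto
    show "inj_on x {1..N}"
    proof (rule inj_onI, rule ccontr)
      fix i k assume ik: "i \<in> {1..N}" "k \<in> {1..N}" "x i = x k" "i \<noteq> k"
      show False
      proof (cases "i > n \<or> k > n")
        case True
        then show False using dist'[of i k] ik L by auto
      next
        case False
        then show False using inj_onD[OF y(2), of i k] ik by (simp add: x_def)
      qed
    qed
    show "x i = y i" if "i \<le> n" for i using that by (simp add: x_def)
    show "norm (x i) \<ge> L" if "i > n" for i
      using far[OF that] L_le[OF that] B0 by linarith
    \<comment> \<open>The interaction of the old points, extended by 0 to all pairs of indices; 1/L
      is then added uniformly to all N^2 pairs.\<close>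
    let ?e = "\<lambda>i k. if k \<in> {1..n} then if i \<in> {1..n} then 1 / norm (y i - y k) else 0 else 0"
    have "1 / norm (x i - x k) \<le> ?e i k + 1 / L" if ik: "i \<in> {1..N}" "k \<in> {1..N}" for i k
    proof (cases "i > n \<or> k > n")
      case True
      show ?thesis
      proof (cases "i = k")
        case False
        then have "1 / norm (x i - x k) \<le> 1 / L"
          using dist'[of i k] True ik L by (intro frac_le) auto
        moreover have "0 \<le> ?e i k" by simp
        ultimately show ?thesis by linarith
      qed (use L in auto)
    next
      case False
      then show ?thesis using ik L by (simp add: x_def)
    qed
    then have "(\<Sum>i=1..N. \<Sum>k=1..N. 1 / norm (x i - x k)) \<le> (\<Sum>i=1..N. \<Sum>k=1..N. ?e i k + 1 / L)"
      by (intro sum_mono)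
    also have "\<dots> = (\<Sum>i=1..N. \<Sum>k=1..N. ?e i k) + (real N)\<^sup>2 / L"
      by (simp add: sum.distrib power2_eq_square)
    also have "(\<Sum>i=1..N. \<Sum>k=1..N. ?e i k) =
        (\<Sum>i=1..N. if i \<in> {1..n} then \<Sum>k=1..n. 1 / norm (y i - y k) else 0)"
    proof (intro sum.cong refl)
      fix i
      have "(\<Sum>k=1..N. ?e i k) = (\<Sum>k\<in>{1..N} \<inter> {1..n}. if i \<in> {1..n} then 1 / norm (y i - y k) else 0)"
        by (rule sum.inter_restrict[symmetric]) simp
      also have "{1..N} \<inter> {1..n} = {1..n}" using n by auto
      finally show "(\<Sum>k=1..N. ?e i k) = (if i \<in> {1..n} then \<Sum>k=1..n. 1 / norm (y i - y k) else 0)"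
        by (cases "i \<in> {1..n}") (simp_all only: if_True if_False simp_thms sum.neutral_const)
    qed
    also have "\<dots> = (\<Sum>i\<in>{1..N} \<inter> {1..n}. \<Sum>k=1..n. 1 / norm (y i - y k))"
      by (rule sum.inter_restrict[symmetric]) simp
    also have "{1..N} \<inter> {1..n} = {1..n}" using n by auto
    finally show "(\<Sum>i=1..N. \<Sum>k=1..N. 1 / norm (x i - x k)) \<le>
        (\<Sum>i=1..n. \<Sum>k=1..n. 1 / norm (y i - y k)) + (real N)\<^sup>2 / L" .
  qed
qed

text \<open>The number of particles that carry the mass \<open>m\<close> of the limit; the rest will escape.\<close>

lemma truncated_floor_tendsto:
  fixes N :: "nat \<Rightarrow> nat" and W :: "nat \<Rightarrow> real"
  assumes W: "\<And>j. W j > 0" "filterlim W at_top sequentially"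
    and q: "(\<lambda>j. real (N j) / W j) \<longlonglongrightarrow> \<Lambda>" and m: "0 \<le> m" "m \<le> \<Lambda>"
  shows "(\<lambda>j. real (min (N j) (nat \<lfloor>m * W j\<rfloor>)) / W j) \<longlonglongrightarrow> m"
proof -
  have "(\<lambda>j. real (nat \<lfloor>m * W j\<rfloor>) / W j) \<longlonglongrightarrow> m"
  proof (rule tendsto_sandwich[OF _ _ _ tendsto_const])
    have fl: "real (nat \<lfloor>m * W j\<rfloor>) = of_int \<lfloor>m * W j\<rfloor>" for j
      using m(1) W(1)[of j] by simp
    show "\<forall>\<^sub>F j in sequentially. m - 1 / W j \<le> real (nat \<lfloor>m * W j\<rfloor>) / W j"
    proof (intro always_eventually allI)
      fix j
      have "m * W j - 1 \<le> of_int \<lfloor>m * W j\<rfloor>" by linarith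
      then have "(m * W j - 1) / W j \<le> of_int \<lfloor>m * W j\<rfloor> / W j"
        using W(1)[of j] by (intro divide_right_mono) auto
      then show "m - 1 / W j \<le> real (nat \<lfloor>m * W j\<rfloor>) / W j"
        unfolding fl using W(1)[of j] by (simp add: diff_divide_distrib)
    qed
    show "\<forall>\<^sub>F j in sequentially. real (nat \<lfloor>m * W j\<rfloor>) / W j \<le> m"
    proof (intro always_eventually allI)
      fix j show "real (nat \<lfloor>m * W j\<rfloor>) / W j \<le> m"
        unfolding fl using W(1)[of j] by (simp add: pos_divide_le_eq)
    qed
    have "(\<lambda>j. m - 1 / W j) \<longlonglongrightarrow> m - 0"
      by (intro tendsto_diff tendsto_const real_tendsto_divide_at_top[OF tendsto_const W(2)])
    then show "(\<lambda>j. m - 1 / W j) \<longlonglongrightarrow> m" by simp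
  qed
  \<comment> \<open>The floor may exceed N, in particular when m = \<Lambda>. Since N/W tends to
    \<Lambda> \<ge> m, the truncation leaves the limit unchanged.\<close>
  from tendsto_min[OF q this]
  have "(\<lambda>j. min (real (N j) / W j) (real (nat \<lfloor>m * W j\<rfloor>) / W j)) \<longlonglongrightarrow> m"
    using m(2) by (simp add: min_absorb2)
  moreover have "min (real (N j) / W j) (real (nat \<lfloor>m * W j\<rfloor>) / W j) =
      real (min (N j) (nat \<lfloor>m * W j\<rfloor>)) / W j" for j
    using W(1)[of j] by (auto simp: min_def divide_le_cancel)
  ultimately show ?thesis by simp
qed

text \<open>Sampling from the normalized measure gives energy about E/m^2 with m the mass, and the
  factor (n/W)^2, which tends to m^2, restores E. A measure of mass 0 cannot be normalized; there
  \<open>n0\<close> ensures that no points are placed.\<close>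

lemma exists_mass_carrying_points:
  fixes F :: "'a::euclidean_space set" and n :: "nat \<Rightarrow> nat" and W :: "nat \<Rightarrow> real"
  assumes F: "closed F" and \<mu>: "\<mu> \<in> radon_measures_pos F"
    and E: "(\<integral>\<^sup>+p. coulomb (fst p) (snd p) \<partial>(\<mu> \<Otimes>\<^sub>M \<mu>)) \<le> ennreal E" "E \<ge> 0"
    and W: "\<And>j. W j > 0" "filterlim W at_top sequentially"
    and n: "(\<lambda>j. real (n j) / W j) \<longlonglongrightarrow> measure \<mu> F"
    and n0: "measure \<mu> F = 0 \<longrightarrow> (\<forall>j. n j = 0)"
  obtains y :: "nat \<Rightarrow> nat \<Rightarrow> 'a" and b :: "nat \<Rightarrow> real" where
    "\<And>j. y j ` {1..n j} \<subseteq> F" "\<And>j. inj_on (y j) {1..n j}"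
    "\<And>j. (1 / W j)\<^sup>2 * (\<Sum>i=1..n j. \<Sum>k=1..n j. 1 / norm (y j i - y j k)) \<le> b j" "b \<longlonglongrightarrow> E"
    "\<And>f. f \<in> C0 F \<Longrightarrow> (\<lambda>j. 1 / W j * (\<Sum>i=1..n j. f (y j i))) \<longlonglongrightarrow> (\<integral>x. f x \<partial>\<mu>)"
proof (cases "measure \<mu> F = 0")
  case True
  interpret finite_measure \<mu> using finite_measure_radon[OF \<mu>] .
  have "emeasure \<mu> (space \<mu>) = 0" using True by (simp add: space_radon[OF \<mu>] emeasure_eq_measure)
  then have AE: "AE x in \<mu>. False" by (intro AE_I[of _ _ "space \<mu>"]) auto
  have "(\<integral>x. f x \<partial>\<mu>) = 0" for f :: "'a \<Rightarrow> real"
    using AE by (intro integral_eq_zero_AE) (auto elim: eventually_mono)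
  then show thesis
    using n0 True E(2) by (intro that[of "\<lambda>_ _. 0" "\<lambda>_. E"]) auto
next
  case False
  interpret finite_measure \<mu> using finite_measure_radon[OF \<mu>] .
  define m where "m = measure \<mu> F"
  have m: "m > 0" using False by (simp add: m_def zero_less_measure_iff)
  define \<nu> where "\<nu> = density \<mu> (\<lambda>_. ennreal (1 / m))"
  have \<nu>: "\<nu> \<in> radon_measures_pos F" unfolding \<nu>_def by (rule radon_density_const[OF \<mu>])
  have "emeasure \<nu> (space \<nu>) = ennreal (1 / m) * emeasure \<mu> F"
    unfolding \<nu>_def by (simp add: emeasure_density space_radon[OF \<mu>] flip: space_radon[OF \<mu>])
  also have "\<dots> = 1"
    using m by (simp add: emeasure_eq_measure m_def[symmetric] flip: ennreal_mult)
  finally have "prob_space \<nu>" by (intro prob_spaceI)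
  have g: "(\<lambda>p. coulomb (fst p) (snd p)) \<in> borel_measurable (\<mu> \<Otimes>\<^sub>M \<mu>)"
    by (rule measurable_pair_radon[OF \<mu>]) measurable
  have "(\<integral>\<^sup>+p. coulomb (fst p) (snd p) \<partial>(\<nu> \<Otimes>\<^sub>M \<nu>)) \<le> ennreal ((1 / m)\<^sup>2) * ennreal E"
    unfolding \<nu>_def using m
    by (subst nn_integral_pair_density_const[OF finite_measure_axioms g]) (auto intro: mult_left_mono E)
  also have "\<dots> = ennreal ((1 / m)\<^sup>2 * E)" using E(2) by (simp add: ennreal_mult)
  finally have e: "(\<integral>\<^sup>+p. coulomb (fst p) (snd p) \<partial>(\<nu> \<Otimes>\<^sub>M \<nu>)) \<le> ennreal ((1 / m)\<^sup>2 * E)" .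
  obtain x :: "nat \<Rightarrow> nat \<Rightarrow> 'a" where x: "\<And>n. x n ` {1..n} \<subseteq> F" "\<And>n. inj_on (x n) {1..n}"
    "\<And>n. (\<Sum>i=1..n. \<Sum>k=1..n. 1 / norm (x n i - x n k)) / (real n)\<^sup>2 \<le> (1 / m)\<^sup>2 * E + 2 / sqrt (real n)"
    "\<And>f. f \<in> C0 F \<Longrightarrow> (\<lambda>n. (\<Sum>i=1..n. f (x n i)) / real n) \<longlonglongrightarrow> (\<integral>y. f y \<partial>\<nu>)"
    using exists_sampling_sequence[OF F \<nu> \<open>prob_space \<nu>\<close> e] E(2) by auto
  \<comment> \<open>The number of sampled points diverges since n/W has a positive limit and W
    diverges; this allows substituting n j into limits over sample sizes.\<close>
  have "filterlim (\<lambda>j. real (n j) / W j * W j) at_top sequentially"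
    using m by (intro filterlim_tendsto_pos_mult_at_top[OF n _ W(2)]) (simp add: m_def)
  moreover have "real (n j) / W j * W j = real (n j)" for j using W(1)[of j] by simp
  ultimately have nr: "filterlim (\<lambda>j. real (n j)) at_top sequentially" by simp
  then have ninf: "filterlim n at_top sequentially"
    by (simp add: filterlim_sequentially_iff_filterlim_real)
  show thesis
  proof (rule that[of "\<lambda>j. x (n j)" "\<lambda>j. (real (n j) / W j)\<^sup>2 * ((1 / m)\<^sup>2 * E + 2 / sqrt (real (n j)))"])
    show "x (n j) ` {1..n j} \<subseteq> F" "inj_on (x (n j)) {1..n j}" for j using x by auto
    fix j
    have "(1 / W j)\<^sup>2 * (\<Sum>i=1..n j. \<Sum>k=1..n j. 1 / norm (x (n j) i - x (n j) k)) =
        (real (n j) / W j)\<^sup>2 * ((\<Sum>i=1..n j. \<Sum>k=1..n j. 1 / norm (x (n j) i - x (n j) k)) / (real (n j))\<^sup>2)"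
      by (cases "n j = 0") (auto simp: power_divide)
    also have "\<dots> \<le> (real (n j) / W j)\<^sup>2 * ((1 / m)\<^sup>2 * E + 2 / sqrt (real (n j)))"
      by (intro mult_left_mono x(3)) auto
    finally show "(1 / W j)\<^sup>2 * (\<Sum>i=1..n j. \<Sum>k=1..n j. 1 / norm (x (n j) i - x (n j) k)) \<le>
      (real (n j) / W j)\<^sup>2 * ((1 / m)\<^sup>2 * E + 2 / sqrt (real (n j)))" .
  next
    have "(\<lambda>j. (real (n j) / W j)\<^sup>2 * ((1 / m)\<^sup>2 * E + 2 / sqrt (real (n j)))) \<longlonglongrightarrow>
        m\<^sup>2 * ((1 / m)\<^sup>2 * E + 0)"
      using n unfolding m_def[symmetric]
      by (intro tendsto_intros real_tendsto_divide_at_top[OF tendsto_const] filterlim_compose[OF sqrt_at_top nr])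
    also have "m\<^sup>2 * ((1 / m)\<^sup>2 * E + 0) = E" using m by (simp add: power_divide)
    finally show "(\<lambda>j. (real (n j) / W j)\<^sup>2 * ((1 / m)\<^sup>2 * E + 2 / sqrt (real (n j)))) \<longlonglongrightarrow> E" .
  next
    fix f assume f: "f \<in> C0 F"
    have "(\<integral>y. f y \<partial>\<nu>) = 1 / m * (\<integral>y. f y \<partial>\<mu>)"
      unfolding \<nu>_def using m integrable_C0[OF F f \<mu>]
      by (subst integral_density) (auto intro: borel_measurable_integrable)
    then have "m * (\<integral>y. f y \<partial>\<nu>) = (\<integral>y. f y \<partial>\<mu>)" using m by simp
    moreover have "(\<lambda>j. real (n j) / W j * ((\<Sum>i=1..n j. f (x (n j) i)) / real (n j))) \<longlonglongrightarrow> m * (\<integral>y. f y \<partial>\<nu>)"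
      unfolding m_def by (intro tendsto_mult n filterlim_compose[OF x(4)[OF f] ninf])
    moreover have "real (n j) / W j * ((\<Sum>i=1..n j. f (x (n j) i)) / real (n j)) =
        1 / W j * (\<Sum>i=1..n j. f (x (n j) i))" for j
      by (cases "n j = 0") auto
    ultimately show "(\<lambda>j. 1 / W j * (\<Sum>i=1..n j. f (x (n j) i))) \<longlonglongrightarrow> (\<integral>x. f x \<partial>\<mu>)" by simp
  qed
qed

lemma exterior_contains_far_points:
  obtains \<rho> where "{x. norm x \<ge> \<rho>} \<subseteq> exterior M R d"
proof (rule that[of "(\<Sum>\<alpha>=1..M. norm (R \<alpha>)) + d"], safe)
  fix x :: "real^3" assume x: "norm x \<ge> (\<Sum>\<alpha>=1..M. norm (R \<alpha>)) + d"
  show "x \<in> exterior M R d"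
    unfolding exterior_def
  proof (intro DiffI UNIV_I notI)
    assume "x \<in> (\<Union>\<alpha>\<in>{1..M}. ball (R \<alpha>) d)"
    then obtain \<alpha> where \<alpha>: "\<alpha> \<in> {1..M}" "norm (x - R \<alpha>) < d"
      by (auto simp: dist_norm norm_minus_commute)
    have "norm (R \<alpha>) \<le> (\<Sum>\<alpha>=1..M. norm (R \<alpha>))"
      using \<alpha>(1) by (intro member_le_sum) auto
    then show False using x \<alpha>(2) norm_triangle_ineq2[of x "R \<alpha>"] by linarith
  qed
qed

text \<open>At most N points of weight 1/W escape, so their total mass stays bounded, while f is
  uniformly small where they are.\<close>

lemma far_points_contribution_tendsto_0:
  fixes x :: "nat \<Rightarrow> nat \<Rightarrow> 'a::real_normed_vector"
  assumes f: "f \<in> C0 F" and xF: "\<And>j. x j ` {1..N j} \<subseteq> F"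
    and far: "\<And>j i. i > n j \<Longrightarrow> norm (x j i) \<ge> real j + 1"
    and W: "\<And>j. W j > 0" and q: "(\<lambda>j. real (N j) / W j) \<longlonglongrightarrow> \<Lambda>"
  shows "(\<lambda>j. 1 / W j * (\<Sum>i=Suc (n j)..N j. f (x j i))) \<longlonglongrightarrow> 0"
proof (rule tendstoI)
  fix e :: real assume "e > 0"
  define e' where "e' = e / (\<bar>\<Lambda>\<bar> + 1)"
  have e': "e' > 0" "(\<bar>\<Lambda>\<bar> + 1) * e' = e" using \<open>e > 0\<close> by (auto simp: e'_def)
  obtain b where b: "\<And>x. x \<in> F \<Longrightarrow> b \<le> norm x \<Longrightarrow> \<bar>f x\<bar> < e'"
    using f e'(1) unfolding C0_iff by blast
  have "\<forall>\<^sub>F j in sequentially. b \<le> real j"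
    using filterlim_real_sequentially by (auto simp: filterlim_at_top)
  moreover have "\<forall>\<^sub>F j in sequentially. real (N j) / W j < \<bar>\<Lambda>\<bar> + 1"
    by (rule order_tendstoD(2)[OF q]) simp
  ultimately show "\<forall>\<^sub>F j in sequentially. dist (1 / W j * (\<Sum>i=Suc (n j)..N j. f (x j i))) 0 < e"
  proof eventually_elim
    fix j assume j: "b \<le> real j" "real (N j) / W j < \<bar>\<Lambda>\<bar> + 1"
    have "\<bar>f (x j i)\<bar> \<le> e'" if "i \<in> {Suc (n j)..N j}" for i
    proof (rule less_imp_le, rule b)
      show "x j i \<in> F" using xF[of j] that by (auto simp: image_subset_iff)
      show "b \<le> norm (x j i)" using far[where j=j and i=i] that j(1) by simp
    qed
    then have "(\<Sum>i=Suc (n j)..N j. \<bar>f (x j i)\<bar>) \<le> (\<Sum>i=Suc (n j)..N j. e')"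
      by (rule sum_mono)
    also have "\<dots> \<le> real (N j) * e'" using e'(1) by simp
    finally have "\<bar>\<Sum>i=Suc (n j)..N j. f (x j i)\<bar> \<le> real (N j) * e'"
      using sum_abs[of "\<lambda>i. f (x j i)" "{Suc (n j)..N j}"] by linarith
    then have "1 / W j * \<bar>\<Sum>i=Suc (n j)..N j. f (x j i)\<bar> \<le> 1 / W j * (real (N j) * e')"
      using W[of j] by (intro mult_left_mono) auto
    also have "\<dots> = real (N j) / W j * e'" by simp
    also have "\<dots> < (\<bar>\<Lambda>\<bar> + 1) * e'" using j(2) e'(1) by (rule mult_strict_right_mono)
    finally show "dist (1 / W j * (\<Sum>i=Suc (n j)..N j. f (x j i))) 0 < e"
      using W[of j] e'(2) by (simp add: dist_real_def abs_mult)
  qed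
qed

section \<open>Assembly of the recovery sequence\<close>

text \<open>Sampling bounds the energies only from above, hence the majorants b. That the functional
  values themselves converge follows later by combining this with the lower bound along the same
  sequence.\<close>

lemma exists_recovery_sequence:
  fixes R :: "nat \<Rightarrow> real^3" and M :: nat and d :: real and Z :: "nat \<Rightarrow> nat \<Rightarrow> real"
  defines "F \<equiv> exterior M R d" and "W \<equiv> \<lambda>j. \<Sum>\<alpha>=1..M. Z j \<alpha>"
  assumes d: "d > 0" and W: "\<And>j. W j > 0" "filterlim W at_top sequentially"
    and q: "(\<lambda>j. real (N j) / W j) \<longlonglongrightarrow> \<Lambda>"
    and z: "\<And>\<alpha>. \<alpha> \<in> {1..M} \<Longrightarrow> (\<lambda>j. Z j \<alpha> / W j) \<longlonglongrightarrow> z \<alpha>"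
    and \<mu>: "\<mu> \<in> radon_measures_pos F" and I: "I_limit M R d \<Lambda> z \<mu> \<noteq> \<infinity>"
  obtains \<mu>s b where "\<And>j. \<mu>s j \<in> radon_measures_pos F"
    "\<And>f. f \<in> C0 F \<Longrightarrow> (\<lambda>j. \<integral>x. f x \<partial>\<mu>s j) \<longlonglongrightarrow> (\<integral>x. f x \<partial>\<mu>)"
    "\<And>j. V_tilde M R d (N j) (Z j) (\<mu>s j) \<le> ereal (b j)"
    "(\<lambda>j. ereal (b j)) \<longlonglongrightarrow> I_limit M R d \<Lambda> z \<mu>"
proof -
  have F: "closed F" unfolding F_def by (rule closed_exterior)
  interpret finite_measure \<mu> using finite_measure_radon[OF \<mu>] .
  have mass: "measure \<mu> F \<le> \<Lambda>"
    using I by (auto simp: I_limit_def F_def Let_def split: if_splits)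
  have I_eq: "I_limit M R d \<Lambda> z \<mu> = - ereal (attraction M R z \<mu>) + ereal (1/2) * repulsion (F \<times> F) \<mu>"
    using mass by (simp add: I_limit_def F_def Let_def)
  have "repulsion (F \<times> F) \<mu> \<noteq> \<infinity>" using I unfolding I_eq by auto
  moreover have "repulsion (F \<times> F) \<mu> \<ge> 0" by (simp add: repulsion_def)
  ultimately obtain E where E: "repulsion (F \<times> F) \<mu> = ereal E" "E \<ge> 0"
    by (cases "repulsion (F \<times> F) \<mu>") auto
  have "(\<integral>\<^sup>+p. coulomb (fst p) (snd p) \<partial>(\<mu> \<Otimes>\<^sub>M \<mu>)) =
      (\<integral>\<^sup>+p\<in>F \<times> F. coulomb (fst p) (snd p) \<partial>(\<mu> \<Otimes>\<^sub>M \<mu>))"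
    by (intro nn_integral_cong) (auto simp: space_pair_measure space_radon[OF \<mu>])
  also have "\<dots> = ennreal E"
    using E(1) unfolding repulsion_def enn2ereal_inject[symmetric] enn2ereal_ennreal[OF E(2)] .
  finally have energy: "(\<integral>\<^sup>+p. coulomb (fst p) (snd p) \<partial>(\<mu> \<Otimes>\<^sub>M \<mu>)) \<le> ennreal E" by simp
  define n where "n j = min (N j) (nat \<lfloor>measure \<mu> F * W j\<rfloor>)" for j
  have n: "(\<lambda>j. real (n j) / W j) \<longlonglongrightarrow> measure \<mu> F"
    unfolding n_def by (rule truncated_floor_tendsto[OF W q measure_nonneg mass])
  have n0: "measure \<mu> F = 0 \<longrightarrow> (\<forall>j. n j = 0)" by (simp add: n_def)
  obtain y :: "nat \<Rightarrow> nat \<Rightarrow> real^3" and b where y: "\<And>j. y j ` {1..n j} \<subseteq> F" "\<And>j. inj_on (y j) {1..n j}"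
    "\<And>j. (1 / W j)\<^sup>2 * (\<Sum>i=1..n j. \<Sum>k=1..n j. 1 / norm (y j i - y j k)) \<le> b j" "b \<longlonglongrightarrow> E"
    "\<And>f. f \<in> C0 F \<Longrightarrow> (\<lambda>j. 1 / W j * (\<Sum>i=1..n j. f (y j i))) \<longlonglongrightarrow> (\<integral>x. f x \<partial>\<mu>)"
    by (rule exists_mass_carrying_points[OF F \<mu> energy E(2) W n n0]) blast
  obtain \<rho> where \<rho>: "{x. norm x \<ge> \<rho>} \<subseteq> F"
    unfolding F_def by (rule exterior_contains_far_points)
  \<comment> \<open>The separation L = j + 1 is positive for every j and diverges, so the escaping
    points vanish against test functions and cost no energy in the limit.\<close>
  have "\<exists>x. x ` {1..N j} \<subseteq> F \<and> inj_on x {1..N j} \<and> (\<forall>i\<le>n j. x i = y j i) \<and>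
    (\<forall>i>n j. norm (x i) \<ge> real j + 1) \<and>
    (\<Sum>i=1..N j. \<Sum>k=1..N j. 1 / norm (x i - x k)) \<le>
     (\<Sum>i=1..n j. \<Sum>k=1..n j. 1 / norm (y j i - y j k)) + (real (N j))\<^sup>2 / (real j + 1)" for j
  proof -
    have "n j \<le> N j" "real j + 1 > 0" by (auto simp: n_def)
    then show ?thesis
      by (rule extend_by_distant_points[OF \<rho> y(1,2)]) blast
  qed
  then obtain x where x: "\<And>j. x j ` {1..N j} \<subseteq> F" "\<And>j. inj_on (x j) {1..N j}"
    "\<And>j i. i \<le> n j \<Longrightarrow> x j i = y j i" "\<And>j i. i > n j \<Longrightarrow> norm (x j i) \<ge> real j + 1"
    "\<And>j. (\<Sum>i=1..N j. \<Sum>k=1..N j. 1 / norm (x j i - x j k)) \<le>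
     (\<Sum>i=1..n j. \<Sum>k=1..n j. 1 / norm (y j i - y j k)) + (real (N j))\<^sup>2 / (real j + 1)"
    by metis
  define \<mu>s where "\<mu>s j = dirac_sum F (1 / W j) (N j) (x j)" for j
  have \<mu>s: "\<mu>s j \<in> radon_measures_pos F" for j
    unfolding \<mu>s_def by (rule dirac_sum_radon[OF x(1)])
  have lim: "(\<lambda>j. \<integral>x. f x \<partial>\<mu>s j) \<longlonglongrightarrow> (\<integral>x. f x \<partial>\<mu>)" if f: "f \<in> C0 F" for f
  proof -
    have fm: "f \<in> borel_measurable (restrict_space borel F)"
      using f by (intro borel_measurable_continuous_on_restrict) (simp add: C0_iff)
    have "(\<integral>x. f x \<partial>\<mu>s j) = 1 / W j * (\<Sum>i=1..n j. f (y j i)) + 1 / W j * (\<Sum>i=Suc (n j)..N j. f (x j i))"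
      for j
    proof -
      have "(\<integral>x. f x \<partial>\<mu>s j) = 1 / W j * (\<Sum>i=1..N j. f (x j i))"
        unfolding \<mu>s_def using W(1)[of j] by (intro integral_dirac_sum[OF x(1) fm]) simp
      also have "{1..N j} = {1..n j} \<union> {Suc (n j)..N j}" by (auto simp: n_def)
      also have "(\<Sum>i\<in>{1..n j} \<union> {Suc (n j)..N j}. f (x j i)) =
          (\<Sum>i=1..n j. f (x j i)) + (\<Sum>i=Suc (n j)..N j. f (x j i))"
        by (intro sum.union_disjoint) auto
      also have "(\<Sum>i=1..n j. f (x j i)) = (\<Sum>i=1..n j. f (y j i))"
        by (intro sum.cong) (auto simp: x(3))
      finally show ?thesis by (simp only: distrib_left)
    qed
    moreover have "(\<lambda>j. 1 / W j * (\<Sum>i=1..n j. f (y j i)) + 1 / W j * (\<Sum>i=Suc (n j)..N j. f (x j i)))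
        \<longlonglongrightarrow> (\<integral>x. f x \<partial>\<mu>) + 0"
      by (intro tendsto_add y(5)[OF f] far_points_contribution_tendsto_0[OF f x(1,4) W(1) q])
    ultimately show ?thesis by simp
  qed
  \<comment> \<open>The last summand bounds the energy cost of the distant points; it tends to 0
    because N/W converges.\<close>
  define B where "B j = - attraction M R (\<lambda>\<alpha>. Z j \<alpha> / W j) (\<mu>s j) +
    1/2 * (b j + (real (N j) / W j)\<^sup>2 * (1 / (real j + 1)))" for j
  have V_le: "V_tilde M R d (N j) (Z j) (\<mu>s j) \<le> ereal (B j)" for j
  proof -
    have "(1 / W j)\<^sup>2 * (\<Sum>i=1..N j. \<Sum>k=1..N j. 1 / norm (x j i - x j k)) \<le>
        (1 / W j)\<^sup>2 * ((\<Sum>i=1..n j. \<Sum>k=1..n j. 1 / norm (y j i - y j k)) + (real (N j))\<^sup>2 / (real j + 1))"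
      by (intro mult_left_mono x(5)) simp
    also have "\<dots> = (1 / W j)\<^sup>2 * (\<Sum>i=1..n j. \<Sum>k=1..n j. 1 / norm (y j i - y j k))
        + (real (N j) / W j)\<^sup>2 * (1 / (real j + 1))"
      by (simp add: distrib_left power_divide)
    also have "\<dots> \<le> b j + (real (N j) / W j)\<^sup>2 * (1 / (real j + 1))"
      by (intro add_right_mono y(3))
    finally have "- attraction M R (\<lambda>\<alpha>. Z j \<alpha> / W j) (\<mu>s j) +
        1/2 * ((1 / W j)\<^sup>2 * (\<Sum>i=1..N j. \<Sum>k=1..N j. 1 / norm (x j i - x j k))) \<le> B j"
      unfolding B_def by (rule add_left_mono[OF mult_left_mono]) simp
    then show ?thesis
      using V_tilde_dirac_sum[of "x j" "N j" M R d "Z j"] x(1,2)[of j] W(1)[of j]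
      unfolding \<mu>s_def F_def W_def by simp
  qed
  have att: "(\<lambda>j. attraction M R (\<lambda>\<alpha>. Z j \<alpha> / W j) (\<mu>s j)) \<longlonglongrightarrow> attraction M R z \<mu>"
    by (rule attraction_tendsto[OF d \<mu>s[unfolded F_def] \<mu>[unfolded F_def] lim[unfolded F_def] z])
  have "(\<lambda>j. 1 / (real j + 1)) \<longlonglongrightarrow> 0"
    using LIMSEQ_inverse_real_of_nat by (simp add: inverse_eq_divide add.commute)
  with att have "B \<longlonglongrightarrow> - attraction M R z \<mu> + 1/2 * (E + \<Lambda>\<^sup>2 * 0)"
    unfolding B_def by (intro tendsto_intros y(4) q)
  then have "(\<lambda>j. ereal (B j)) \<longlonglongrightarrow> I_limit M R d \<Lambda> z \<mu>"
    unfolding I_eq E(1) by simp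
  with \<mu>s lim V_le show thesis by (rule that)
qed

theorem theorem1p3:
  fixes M :: nat and R :: "nat \<Rightarrow> real^3" and d :: real
    and N :: "nat \<Rightarrow> nat" and Z :: "nat \<Rightarrow> nat \<Rightarrow> real"
    and \<Lambda> :: real and z :: "nat \<Rightarrow> real"
  assumes "M \<ge> 1" and "d > 0"
    and "\<And>j \<alpha>. \<alpha> \<in> {1..M} \<Longrightarrow> Z j \<alpha> > 0"
    and "filterlim N at_top sequentially"
    and "filterlim (\<lambda>j. \<Sum>\<alpha>=1..M. Z j \<alpha>) at_top sequentially"
    and "(\<lambda>j. real (N j) / (\<Sum>\<alpha>=1..M. Z j \<alpha>)) \<longlonglongrightarrow> \<Lambda>" and "\<Lambda> > 0"
    and "\<And>\<alpha>. \<alpha> \<in> {1..M} \<Longrightarrow> (\<lambda>j. Z j \<alpha> / (\<Sum>\<beta>=1..M. Z j \<beta>)) \<longlonglongrightarrow> z \<alpha>"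
  shows "gamma_converges (weak_star_topology (exterior M R d))
           (\<lambda>j. V_tilde M R d (N j) (Z j)) (I_limit M R d \<Lambda> z)"
proof -
  let ?F = "exterior M R d" and ?V = "\<lambda>j. V_tilde M R d (N j) (Z j)" and ?I = "I_limit M R d \<Lambda> z"
  have W: "(\<Sum>\<alpha>=1..M. Z j \<alpha>) > 0" for j
    using assms(1,3) by (intro sum_pos) auto
  have lower: "?I \<mu> \<le> liminf (\<lambda>j. ?V j (\<mu>s j))"
    if \<mu>: "\<mu> \<in> radon_measures_pos ?F" and \<mu>s: "\<And>j. \<mu>s j \<in> radon_measures_pos ?F"
      and lim: "limitin (weak_star_topology ?F) \<mu>s \<mu> sequentially" for \<mu> \<mu>s
    using lim limitin_weak_star[OF \<mu>s \<mu>]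
    by (intro I_limit_le_liminf_V_tilde[OF assms(2) W assms(5,6,8) \<mu>s \<mu>]) auto
  have upper: "\<exists>\<mu>s. (\<forall>j. \<mu>s j \<in> radon_measures_pos ?F) \<and>
      limitin (weak_star_topology ?F) \<mu>s \<mu> sequentially \<and> (\<lambda>j. ?V j (\<mu>s j)) \<longlonglongrightarrow> ?I \<mu>"
    if \<mu>: "\<mu> \<in> radon_measures_pos ?F" for \<mu>
  proof (cases "?I \<mu> = \<infinity>")
    case True
    have lim: "limitin (weak_star_topology ?F) (\<lambda>_. \<mu>) \<mu> sequentially"
      by (simp add: limitin_weak_star \<mu>)
    have "liminf (\<lambda>j. ?V j \<mu>) = \<infinity>"
      using lower[OF \<mu> \<mu> lim] True by simp
    moreover have "liminf (\<lambda>j. ?V j \<mu>) \<le> limsup (\<lambda>j. ?V j \<mu>)"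
      by (rule Liminf_le_Limsup) simp
    ultimately have "(\<lambda>j. ?V j \<mu>) \<longlonglongrightarrow> ?I \<mu>"
      unfolding True by (intro Liminf_eq_Limsup) auto
    with lim \<mu> show ?thesis by (intro exI[of _ "\<lambda>_. \<mu>"]) auto
  next
    case False
    obtain \<mu>s b where \<mu>s: "\<And>j. \<mu>s j \<in> radon_measures_pos ?F"
      "\<And>f. f \<in> C0 ?F \<Longrightarrow> (\<lambda>j. \<integral>x. f x \<partial>\<mu>s j) \<longlonglongrightarrow> (\<integral>x. f x \<partial>\<mu>)"
      "\<And>j. ?V j (\<mu>s j) \<le> ereal (b j)" "(\<lambda>j. ereal (b j)) \<longlonglongrightarrow> ?I \<mu>"
      using exists_recovery_sequence[OF assms(2) W assms(5,6,8) \<mu> False] by blast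
    have lim: "limitin (weak_star_topology ?F) \<mu>s \<mu> sequentially"
      using \<mu>s(2) by (simp add: limitin_weak_star[OF \<mu>s(1) \<mu>])
    have "limsup (\<lambda>j. ?V j (\<mu>s j)) \<le> limsup (\<lambda>j. ereal (b j))"
      by (intro Limsup_mono always_eventually allI \<mu>s(3))
    also have "\<dots> = ?I \<mu>" by (rule lim_imp_Limsup[OF _ \<mu>s(4)]) simp
    finally have le: "limsup (\<lambda>j. ?V j (\<mu>s j)) \<le> ?I \<mu>" .
    have "liminf (\<lambda>j. ?V j (\<mu>s j)) \<le> limsup (\<lambda>j. ?V j (\<mu>s j))"
      by (rule Liminf_le_Limsup) simp
    with le lower[OF \<mu> \<mu>s(1) lim] have "(\<lambda>j. ?V j (\<mu>s j)) \<longlonglongrightarrow> ?I \<mu>"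
      by (intro Liminf_eq_Limsup) auto
    with lim \<mu>s(1) show ?thesis by blast
  qed
  show ?thesis
    unfolding gamma_converges_def topspace_weak_star using lower upper by blast
qed

end
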